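(* Let $G$ be a Lie group with Lie algebra $\mathfrak g$, let $\pi:Q\to Q/G$ be a principal $G$-bundle, and let $\mathcal A_d:Q\times Q\to G$ and $\mathfrak A:TQ\to\mathfrak g$ be an affine discrete connection and a principal connection on it, respectively. Let $(Q,L_d,f_d)$ be a forced discrete mechanical system with symmetry group $G$. Let $(v_\cdot,\tau_\cdot)=((v_0,\tau_1),\ldots,(v_{N-1},\tau_N))$ be a discrete curve on $\tilde G\times(Q/G)$ such that $\tau_k=\mathrm{pr}^{Q/G}(v_k)$ for all $1\le k\le N-1$. (1) Given $q_0\in Q$ such that $\pi(q_0)=\mathrm{pr}^{Q/G}(v_0)$, there exists a unique discrete curve $q_\cdot=(q_0,\ldots,q_N)$ in $Q$, starting at $q_0$, such that $\Upsilon(q_k,q_{k+1})=(v_k,\tau_{k+1})$ for all $0\le k\le N-1$. (2) Let $q_\cdot$ be the curve of (1) and $w_k:=\mathcal A_d(q_k,q_{k+1})$ for $0\le k\le N-1$. Suppose that for every $1\le k\le N-1$ one has $\phi_{f_d}=0$ in $T^*_{\tau_k}(Q/G)$ and $\psi_{f_d}=0$ in $\mathfrak g^*$, where $$\begin{aligned}\phi_{f_d}:={}&D_1\check L_d(q_k,w_k,\tau_{k+1})\circ h^{q_k}+D_3\check L_d(q_{k-1},w_{k-1},\tau_k)\\&+D_2\check L_d(q_k,w_k,\tau_{k+1})\,D_1\mathcal A_d(q_k,q_{k+1})\circ h^{q_k}\\&+D_2\check L_d(q_{k-1},w_{k-1},\tau_k)\,D_2\mathcal A_d(q_{k-1},q_k)\circ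 h^{q_k}\\&+\check f_d^1(q_k,w_k,\tau_{k+1})\circ h^{q_k}+\check f_d^3(q_{k-1},w_{k-1},\tau_k)\\&+\check f_d^2(q_k,w_k,\tau_{k+1})\,D_1\mathcal A_d(q_k,q_{k+1})\circ h^{q_k}\\&+\check f_d^2(q_{k-1},w_{k-1},\tau_k)\,D_2\mathcal A_d(q_{k-1},q_k)\circ h^{q_k}\end{aligned}$$ and, for $\xi\in\mathfrak g$, $$\begin{aligned}\psi_{f_d}(\xi):={}&\big(D_2\check L_d(q_{k-1},w_{k-1},\tau_k)\,w_{k-1}^{-1}-D_2\check L_d(q_k,w_k,\tau_{k+1})\,w_k^{-1}\big)(\xi)\\&+\big(\check f_d^1(q_k,w_k,\tau_{k+1})+\check f_d^2(q_k,w_k,\tau_{k+1})D_1\mathcal A_d(q_k,q_{k+1})\\&\quad+\check f_d^2(q_{k-1},w_{k-1},\tau_k)D_2\mathcal A_d(q_{k-1},q_k)\big)\big(\xi_Q(q_k)\big).\end{aligned}$$ Then $q_\cdot$ is a trajectory of $(Q,L_d,f_d)$.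
   Context: Partial derivatives: for a smooth map $H$ on a product of manifolds, $D_iH$ denotes the restriction of $TH$ to vectors tangent to the $i$-th factor; for real-valued $H$ it is a covector on the $i$-th factor. Juxtaposition such as $D_2\check L_d\,D_1\mathcal A_d$ denotes composition of linear maps. Forced discrete mechanical system (FDMS): a triple $(Q,L_d,f_d)$ with $Q$ an $n$-dimensional manifold, $L_d:Q\times Q\to\mathbb R$ smooth, $f_d$ a $1$-form on $Q\times Q$. A discrete curve in a manifold is a finite sequence of points indexed by consecutive integers. A discrete curve $q_\cdot=(q_0,\ldots,q_N)$ in $Q$ is a trajectory of $(Q,L_d,f_d)$ if $$\sum_{k=0}^{N-1}dL_d(q_k,q_{k+1})(\delta q_k,\delta q_{k+1})+\sum_{k=0}^{N-1}f_d(q_k,q_{k+1})(\delta q_k,\delta q_{k+1})=0$$ for all $\delta q_k\in T_{q_k}Q$ ($0\le k\le N$) with $\delta q_0=0$, $\delta q_N=0$. Symmetry group: $G$ is a Lie group acting on $Q$ on the left by $l^Q$ so that $\pi:Q\to Q/G$ is a principal $G$-bundle; $G$ is a symmetry group of $(Q,L_d,f_d)$ if, for the diagonal action on $Q\times Q$, $L_d$ is $G$-invariant and $f_d:Q\times Q\to T^*(Q\times Q)$ is $G$-equivariant for the cotangent lift of the diagonal action (equivalently $f_d$ is a $G$-invariant $1$-form). Infinitesimal generator: $\xi_Q(q)=\frac{d}{dt}|_{t=0}l^Q_{\exp(t\xi)}(q)$. Principal connection on $\pi$: a $\mathfrak g$-valued $1$-form $\mathfrak A$ on $Q$ with $\mathfrak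 A(\xi_Q(q))=\xi$ and $\mathfrak A(Tl_g^Q(v))=\mathrm{Ad}_g(\mathfrak A(v))$. Its horizontal lift $h^q(u)$ of $u\in T_{\pi(q)}(Q/G)$ is the unique vector of $T_qQ$ in $\ker\mathfrak A$ with $T\pi(h^q(u))=u$. Affine discrete connection: let $\gamma:Q\to G$ be smooth and $G$-equivariant for $l^Q$ and the conjugation action of $G$ on itself. An affine discrete connection of level $\gamma$ is a smooth map $\mathcal A_d:Q\times Q\to G$ with (i) $\mathcal A_d(l^Q_{g_0}(q_0),l^Q_{g_1}(q_1))=g_1\mathcal A_d(q_0,q_1)g_0^{-1}$ and (ii) $\mathcal A_d(q,l^Q_{\gamma(q)}(q))=e$. (It is assumed defined on all of $Q\times Q$.) Reduced space: $\tilde G:=(Q\times G)/G$, with $G$ acting by $l^Q$ on $Q$ and by conjugation on $G$; $\rho:Q\times G\to\tilde G$ is the quotient map and $\mathrm{pr}^{Q/G}:\tilde G\to Q/G$ is the bundle projection $\rho(q,g)\mapsto\pi(q)$. The map $\tilde\Phi_{\mathcal A_d}:Q\times Q\to Q\times G\times(Q/G)$, $\tilde\Phi_{\mathcal A_d}(q_0,q_1)=(q_0,\mathcal A_d(q_0,q_1),\pi(q_1))$, is a diffeomorphism with inverse $\tilde\Psi_{\mathcal A_d}$. The map $\Upsilon:Q\times Q\to\tilde G\times Q/G$ is $\Upsilon(q_0,q_1)=(\rho(q_0,\mathcal A_d(q_0,q_1)),\pi(q_1))$. $\check L_d:=L_d\circ\tilde\Psi_{\mathcal A_d}:Q\times G\times(Q/G)\to\mathbb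 R$. $\check f_d:=\tilde\Psi_{\mathcal A_d}^*f_d\in\Omega^1(Q\times G\times Q/G)$, decomposed as $\check f_d(q_0,w_0,\tau_1)(\delta q_0,\delta w_0,\delta\tau_1)=\check f_d^1(q_0,w_0,\tau_1)(\delta q_0)+\check f_d^2(q_0,w_0,\tau_1)(\delta w_0)+\check f_d^3(q_0,w_0,\tau_1)(\delta\tau_1)$. Notation: for $w\in G$ and $\alpha\in T_w^*G$, $\alpha w^{-1}\in\mathfrak g^*$ is defined by $(\alpha w^{-1})(\xi):=\alpha(T_eR_w(\xi))$, with $R_w$ right translation by $w$. *)

theory Defs
  imports "HOL-Analysis.Analysis" "HOL-Algebra.Group_Action"
begin

section \<open>Model spaces and smooth functions between them\<close>

definition (in real_inner) orthonormal_basis :: "'a set \<Rightarrow> bool" where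
  "orthonormal_basis E \<longleftrightarrow> finite E \<and> (\<forall>u\<in>E. \<forall>v\<in>E. inner u v = (if u = v then 1 else 0))
     \<and> (\<forall>x. (\<forall>u\<in>E. inner x u = 0) \<longleftrightarrow> x = 0)"

text \<open>
  The class of Euclidean spaces of arbitrary finite dimension. It differs from
  \<^class>\<open>euclidean_space\<close> only in that dimension zero is allowed, which is needed here:
  a discrete group is a Lie group, and \<open>Q/G\<close> is a point if the action is transitive.
\<close>

class model_space = real_inner +
  assumes model_space_basis: "\<exists>E. orthonormal_basis E"

instance euclidean_space \<subseteq> model_space
proof
  have "orthonormal_basis (Basis :: 'a set)"
    by (simp add: orthonormal_basis_def inner_Basis euclidean_all_zero_iff)
  then show "\<exists>E::'a set. orthonormal_basis E" ..
qed

lemma orthonormal_basisD: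
  assumes "orthonormal_basis E"
  shows "finite E"
    and "u \<in> E \<Longrightarrow> v \<in> E \<Longrightarrow> inner u v = (if u = v then 1 else 0)"
    and "(\<And>u. u \<in> E \<Longrightarrow> inner x u = 0) \<Longrightarrow> x = 0"
  using assms[unfolded orthonormal_basis_def, THEN conjunct1]
    assms[unfolded orthonormal_basis_def, THEN conjunct2, THEN conjunct1, rule_format, of u v]
    assms[unfolded orthonormal_basis_def, THEN conjunct2, THEN conjunct2, rule_format, of x]
  by simp_all

lemma model_space_expansion:
  fixes x :: "'a::real_inner"
  assumes E: "orthonormal_basis E"
  shows "(\<Sum>u\<in>E. inner x u *\<^sub>R u) = x"
proof -
  have "inner ((\<Sum>u\<in>E. inner x u *\<^sub>R u) - x) v = 0" if v: "v \<in> E" for v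
  proof -
    have "(\<Sum>u\<in>E. inner x u * inner u v) = (\<Sum>u\<in>E. if u = v then inner x v else 0)"
      by (rule sum.cong) (use orthonormal_basisD(2)[OF E] v in auto)
    then show ?thesis
      using orthonormal_basisD(1)[OF E] v by (simp add: inner_diff_left inner_sum_left)
  qed
  then have "(\<Sum>u\<in>E. inner x u *\<^sub>R u) - x = 0" by (rule orthonormal_basisD(3)[OF E])
  then show ?thesis by simp
qed

instance model_space \<subseteq> banach
proof
  fix X :: "nat \<Rightarrow> 'a" assume X: "Cauchy X"
  obtain E :: "'a set" where E0: "orthonormal_basis E"
    using model_space_basis ..
  note E = orthonormal_basisD[OF E0]
  have "\<exists>c. (\<lambda>n. inner (X n) u) \<longlonglongrightarrow> c" for u
    using bounded_linear.Cauchy[OF bounded_linear_inner_left X, of u]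
    by (simp add: Cauchy_convergent_iff convergent_def)
  then obtain c where c: "\<And>u. (\<lambda>n. inner (X n) u) \<longlonglongrightarrow> c u"
    by metis
  have "(\<lambda>n. \<Sum>u\<in>E. inner (X n) u *\<^sub>R u) \<longlonglongrightarrow> (\<Sum>u\<in>E. c u *\<^sub>R u)"
    by (intro tendsto_sum tendsto_scaleR c tendsto_const)
  moreover have "(\<Sum>u\<in>E. inner (X n) u *\<^sub>R u) = X n" for n
    by (rule model_space_expansion[OF E0])
  ultimately show "convergent X"
    by (auto simp: convergent_def)
qed

instance prod :: (model_space, model_space) model_space
proof
  obtain E :: "'a set" where E0: "orthonormal_basis E"
    using model_space_basis ..
  note E = orthonormal_basisD[OF E0]
  obtain F :: "'b set" where F0: "orthonormal_basis F"
    using model_space_basis ..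
  note F = orthonormal_basisD[OF F0]
  have nz: "0 \<notin> E" "0 \<notin> F"
    using E(2)[of 0 0] F(2)[of 0 0] by auto
  let ?B = "(\<lambda>u. (u, 0)) ` E \<union> (\<lambda>v. (0, v)) ` F :: ('a \<times> 'b) set"
  have "finite ?B" using E(1) F(1) by simp
  moreover have "\<forall>u\<in>?B. \<forall>v\<in>?B. inner u v = (if u = v then 1 else 0)"
    using nz by (auto simp: E(2) F(2) split: if_splits)
  moreover have "(\<forall>u\<in>?B. inner x u = 0) \<longleftrightarrow> x = 0" for x
  proof
    assume x: "\<forall>u\<in>?B. inner x u = 0"
    have "fst x = 0" by (rule E(3)) (use x in \<open>force simp: inner_prod_def\<close>)
    moreover have "snd x = 0" by (rule F(3)) (use x in \<open>force simp: inner_prod_def\<close>)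
    ultimately show "x = 0" by (simp add: prod_eq_iff)
  qed simp
  ultimately have "orthonormal_basis ?B"
    unfolding orthonormal_basis_def by (intro conjI allI)
  then show "\<exists>B::('a \<times> 'b) set. orthonormal_basis B" ..
qed

primrec higher_differentiable_on ::
  "nat \<Rightarrow> 'a::real_normed_vector set \<Rightarrow> ('a \<Rightarrow> 'b::real_normed_vector) \<Rightarrow> bool" where
  "higher_differentiable_on 0 S = (\<lambda>f. continuous_on S f)"
| "higher_differentiable_on (Suc n) S = (\<lambda>f. (\<forall>x\<in>S. f differentiable (at x)) \<and>
     (\<forall>v. higher_differentiable_on n S (\<lambda>x. frechet_derivative f (at x) v)))"

text \<open>Infinite differentiability on an open subset of a finite-dimensional space.\<close>

definition smooth_on :: "'a::real_normed_vector set \<Rightarrow> ('a \<Rightarrow> 'b::real_normed_vector) \<Rightarrow> bool" where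
  "smooth_on S f \<longleftrightarrow> (\<forall>n. higher_differentiable_on n S f)"

section \<open>Manifolds\<close>

type_synonym ('a, 'e) chart = "'a set \<times> ('a \<Rightarrow> 'e)"

definition chart_inv :: "('a, 'e) chart \<Rightarrow> 'e \<Rightarrow> 'a" where
  "chart_inv c = inv_into (fst c) (snd c)"

text \<open>
  Besides its topology and atlas, a manifold carries a choice of a chart around each point.
  It serves to represent tangent spaces: every \<open>T\<^sub>p M\<close> is the model space, a vector \<open>v\<close>
  standing for the tangent vector with coordinates \<open>v\<close> in the chart \<open>chart_at M p\<close>.
  Neither the smooth structure nor the coordinate-free notions depend on this choice.
\<close>

record ('a, 'e) manifold =
  mtop :: "'a topology"
  atlas :: "('a, 'e) chart set"
  chart_at :: "'a \<Rightarrow> ('a, 'e) chart"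

abbreviation points :: "('a, 'e, 'z) manifold_scheme \<Rightarrow> 'a set" where
  "points M \<equiv> topspace (mtop M)"

definition smooth_manifold :: "('a, 'e::model_space) manifold \<Rightarrow> bool" where
  "smooth_manifold M \<longleftrightarrow>
     Hausdorff_space (mtop M) \<and> second_countable (mtop M) \<and>
     (\<forall>(U, \<phi>) \<in> atlas M. openin (mtop M) U \<and> open (\<phi> ` U) \<and>
        homeomorphic_map (subtopology (mtop M) U) (top_of_set (\<phi> ` U)) \<phi>) \<and>
     (\<forall>c \<in> atlas M. \<forall>d \<in> atlas M.
        smooth_on (snd c ` (fst c \<inter> fst d)) (snd d \<circ> chart_inv c)) \<and>
     (\<forall>p \<in> points M. chart_at M p \<in> atlas M \<and> p \<in> fst (chart_at M p))"

definition vector_manifold :: "('e::model_space, 'e) manifold" where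
  "vector_manifold = \<lparr>mtop = euclidean, atlas = {(UNIV, id)}, chart_at = (\<lambda>_. (UNIV, id))\<rparr>"

definition prod_chart :: "('a, 'e) chart \<Rightarrow> ('b, 'f) chart \<Rightarrow> ('a \<times> 'b, 'e \<times> 'f) chart" where
  "prod_chart c d = (fst c \<times> fst d, map_prod (snd c) (snd d))"

text \<open>
  With this choice of charts, \<open>T\<^bsub>(p, q)\<^esub>(M \<times> N)\<close> is literally \<open>T\<^sub>p M \<times> T\<^sub>q N\<close>.
\<close>

definition prod_manifold ::
  "('a, 'e::model_space) manifold \<Rightarrow> ('b, 'f::model_space) manifold
    \<Rightarrow> ('a \<times> 'b, 'e \<times> 'f) manifold" (infixr "\<times>\<^sub>m" 75) where
  "M \<times>\<^sub>m N = \<lparr>mtop = prod_topology (mtop M) (mtop N),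
     atlas = {prod_chart c d | c d. c \<in> atlas M \<and> d \<in> atlas N},
     chart_at = (\<lambda>(p, q). prod_chart (chart_at M p) (chart_at N q))\<rparr>"

definition open_submanifold ::
  "('a, 'e::model_space) manifold \<Rightarrow> 'a set \<Rightarrow> ('a, 'e) manifold" where
  "open_submanifold M U = \<lparr>mtop = subtopology (mtop M) U,
     atlas = {(fst c \<inter> U, snd c) | c. c \<in> atlas M},
     chart_at = (\<lambda>p. (fst (chart_at M p) \<inter> U, snd (chart_at M p)))\<rparr>"

definition smooth_map ::
  "('a, 'e::model_space) manifold \<Rightarrow> ('b, 'f::model_space) manifold \<Rightarrow> ('a \<Rightarrow> 'b) \<Rightarrow> bool" where
  "smooth_map M N F \<longleftrightarrow> continuous_map (mtop M) (mtop N) F \<and>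
     (\<forall>c \<in> atlas M. \<forall>d \<in> atlas N.
        smooth_on (snd c ` {p \<in> fst c. F p \<in> fst d}) (snd d \<circ> F \<circ> chart_inv c))"

definition diffeomorphism ::
  "('a, 'e::model_space) manifold \<Rightarrow> ('b, 'f::model_space) manifold \<Rightarrow> ('a \<Rightarrow> 'b) \<Rightarrow> bool" where
  "diffeomorphism M N F \<longleftrightarrow> bij_betw F (points M) (points N) \<and>
     smooth_map M N F \<and> smooth_map N M (inv_into (points M) F)"

text \<open>The tangent map \<open>T\<^sub>p F : T\<^sub>p M \<rightarrow> T\<^bsub>F p\<^esub> N\<close>.\<close>

definition tangent_map ::
  "('a, 'e::model_space) manifold \<Rightarrow> ('b, 'f::model_space) manifold \<Rightarrow> ('a \<Rightarrow> 'b) \<Rightarrow> 'a \<Rightarrow> 'e \<Rightarrow> 'f"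
  where
  "tangent_map M N F p =
     frechet_derivative (snd (chart_at N (F p)) \<circ> F \<circ> chart_inv (chart_at M p))
       (at (snd (chart_at M p) p))"

abbreviation differential :: "('a, 'e::model_space) manifold \<Rightarrow> ('a \<Rightarrow> real) \<Rightarrow> 'a \<Rightarrow> 'e \<Rightarrow> real" where
  "differential M H \<equiv> tangent_map M vector_manifold H"

text \<open>The velocity at time 0 of a curve defined on the real line.\<close>

definition velocity :: "('a, 'e::model_space) manifold \<Rightarrow> (real \<Rightarrow> 'a) \<Rightarrow> 'e" where
  "velocity M c = tangent_map vector_manifold M c 0 1"

text \<open>
  Smooth 1-forms with values in a vector space. Smoothness is that of the coefficient functions
  in each chart of the atlas.
\<close>

definition one_form ::
  "('a, 'e::model_space) manifold \<Rightarrow> ('a \<Rightarrow> 'e \<Rightarrow> 'v::real_normed_vector) \<Rightarrow> bool" where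
  "one_form M \<omega> \<longleftrightarrow> (\<forall>p \<in> points M. linear (\<omega> p)) \<and>
     (\<forall>c \<in> atlas M. \<forall>v. smooth_on (snd c ` fst c)
        (\<lambda>x. \<omega> (chart_inv c x) (tangent_map vector_manifold M (chart_inv c) x v)))"

definition pullback ::
  "('a, 'e::model_space) manifold \<Rightarrow> ('b, 'f::model_space) manifold \<Rightarrow> ('a \<Rightarrow> 'b)
    \<Rightarrow> ('b \<Rightarrow> 'f \<Rightarrow> 'v) \<Rightarrow> 'a \<Rightarrow> 'e \<Rightarrow> 'v" where
  "pullback M N F \<omega> p v = \<omega> (F p) (tangent_map M N F p v)"

section \<open>Lie groups\<close>

record ('g, 'h) lie_grp = "'g monoid" +
  mfd :: "('g, 'h) manifold"

definition lie_group :: "('g, 'h::model_space) lie_grp \<Rightarrow> bool" where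
  "lie_group G \<longleftrightarrow> group G \<and> smooth_manifold (mfd G) \<and> points (mfd G) = carrier G \<and>
     smooth_map (mfd G \<times>\<^sub>m mfd G) (mfd G) (\<lambda>(g, h). g \<otimes>\<^bsub>G\<^esub> h) \<and>
     smooth_map (mfd G) (mfd G) (\<lambda>g. inv\<^bsub>G\<^esub> g)"

text \<open>The Lie algebra is the tangent space at the identity, hence represented by the type \<open>'h\<close>.\<close>

definition one_parameter_subgroup :: "('g, 'h::model_space) lie_grp \<Rightarrow> (real \<Rightarrow> 'g) \<Rightarrow> bool" where
  "one_parameter_subgroup G c \<longleftrightarrow> smooth_map vector_manifold (mfd G) c \<and>
     (\<forall>s t. c (s + t) = c s \<otimes>\<^bsub>G\<^esub> c t)"

definition lie_exp :: "('g, 'h::model_space) lie_grp \<Rightarrow> 'h \<Rightarrow> 'g" where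
  "lie_exp G \<xi> = (THE c. one_parameter_subgroup G c \<and> velocity (mfd G) c = \<xi>) 1"

definition conjugation :: "('g, 'h) lie_grp \<Rightarrow> 'g \<Rightarrow> 'g \<Rightarrow> 'g" where
  "conjugation G g x = g \<otimes>\<^bsub>G\<^esub> x \<otimes>\<^bsub>G\<^esub> inv\<^bsub>G\<^esub> g"

definition Ad :: "('g, 'h::model_space) lie_grp \<Rightarrow> 'g \<Rightarrow> 'h \<Rightarrow> 'h" where
  "Ad G g = tangent_map (mfd G) (mfd G) (conjugation G g) \<one>\<^bsub>G\<^esub>"

text \<open>\<open>\<alpha> w\<^sup>-\<^sup>1\<close> for a covector \<open>\<alpha>\<close> at \<open>w\<close>.\<close>

definition right_translate_covector ::
  "('g, 'h::model_space) lie_grp \<Rightarrow> 'g \<Rightarrow> ('h \<Rightarrow> real) \<Rightarrow> 'h \<Rightarrow> real" where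
  "right_translate_covector G w \<alpha> \<xi> =
     \<alpha> (tangent_map (mfd G) (mfd G) (\<lambda>x. x \<otimes>\<^bsub>G\<^esub> w) \<one>\<^bsub>G\<^esub> \<xi>)"

section \<open>Actions, principal bundles and connections\<close>

definition smooth_action ::
  "('g, 'h::model_space) lie_grp \<Rightarrow> ('q, 'e::model_space) manifold \<Rightarrow> ('g \<Rightarrow> 'q \<Rightarrow> 'q) \<Rightarrow> bool" where
  "smooth_action G Q l \<longleftrightarrow> group_action G (points Q) l \<and>
     smooth_map (mfd G \<times>\<^sub>m Q) Q (\<lambda>(g, q). l g q)"

definition infinitesimal_generator ::
  "('g, 'h::model_space) lie_grp \<Rightarrow> ('q, 'e::model_space) manifold \<Rightarrow> ('g \<Rightarrow> 'q \<Rightarrow> 'q)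
    \<Rightarrow> 'h \<Rightarrow> 'q \<Rightarrow> 'e" where
  "infinitesimal_generator G Q l \<xi> q = velocity Q (\<lambda>t. l (lie_exp G (t *\<^sub>R \<xi>)) q)"

text \<open>
  \<open>B\<close> is a manifold structure on the set of orbits \<open>Q/G\<close>; the projection \<open>\<pi>\<close> sends \<open>q\<close> to
  \<open>orbit G l q\<close>. Note that \<open>G\<close> acts on the left.
\<close>

definition principal_bundle ::
  "('g, 'h::model_space) lie_grp \<Rightarrow> ('q, 'e::model_space) manifold \<Rightarrow> ('q set, 'b::model_space) manifold
    \<Rightarrow> ('g \<Rightarrow> 'q \<Rightarrow> 'q) \<Rightarrow> bool" where
  "principal_bundle G Q B l \<longleftrightarrow>
     lie_group G \<and> smooth_manifold Q \<and> smooth_manifold B \<and> smooth_action G Q l \<and>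
     points B = orbits G (points Q) l \<and> smooth_map Q B (orbit G l) \<and>
     (\<forall>b \<in> points B. \<exists>U \<Theta>. openin (mtop B) U \<and> b \<in> U \<and>
        diffeomorphism (open_submanifold Q {q \<in> points Q. orbit G l q \<in> U})
          (open_submanifold B U \<times>\<^sub>m mfd G) \<Theta> \<and>
        (\<forall>q \<in> points Q. orbit G l q \<in> U \<longrightarrow> fst (\<Theta> q) = orbit G l q \<and>
           (\<forall>g \<in> carrier G. \<Theta> (l g q) = (orbit G l q, g \<otimes>\<^bsub>G\<^esub> snd (\<Theta> q)))))"

definition principal_connection ::
  "('g, 'h::model_space) lie_grp \<Rightarrow> ('q, 'e::model_space) manifold \<Rightarrow> ('g \<Rightarrow> 'q \<Rightarrow> 'q)
    \<Rightarrow> ('q \<Rightarrow> 'e \<Rightarrow> 'h) \<Rightarrow> bool" where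
  "principal_connection G Q l \<AA> \<longleftrightarrow> one_form Q \<AA> \<and>
     (\<forall>q \<in> points Q. \<forall>\<xi>. \<AA> q (infinitesimal_generator G Q l \<xi> q) = \<xi>) \<and>
     (\<forall>q \<in> points Q. \<forall>g \<in> carrier G. \<forall>v.
        \<AA> (l g q) (tangent_map Q Q (l g) q v) = Ad G g (\<AA> q v))"

definition horizontal_lift ::
  "('g, 'h::model_space) lie_grp \<Rightarrow> ('q, 'e::model_space) manifold \<Rightarrow> ('q set, 'b::model_space) manifold
    \<Rightarrow> ('g \<Rightarrow> 'q \<Rightarrow> 'q) \<Rightarrow> ('q \<Rightarrow> 'e \<Rightarrow> 'h) \<Rightarrow> 'q \<Rightarrow> 'b \<Rightarrow> 'e" where
  "horizontal_lift G Q B l \<AA> q u = (THE v. \<AA> q v = 0 \<and> tangent_map Q B (orbit G l) q v = u)"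

definition affine_discrete_connection ::
  "('g, 'h::model_space) lie_grp \<Rightarrow> ('q, 'e::model_space) manifold \<Rightarrow> ('g \<Rightarrow> 'q \<Rightarrow> 'q)
    \<Rightarrow> ('q \<Rightarrow> 'g) \<Rightarrow> ('q \<times> 'q \<Rightarrow> 'g) \<Rightarrow> bool" where
  "affine_discrete_connection G Q l \<gamma> A\<^sub>d \<longleftrightarrow>
     smooth_map Q (mfd G) \<gamma> \<and>
     (\<forall>g \<in> carrier G. \<forall>q \<in> points Q. \<gamma> (l g q) = conjugation G g (\<gamma> q)) \<and>
     smooth_map (Q \<times>\<^sub>m Q) (mfd G) A\<^sub>d \<and>
     (\<forall>q\<^sub>0 \<in> points Q. \<forall>q\<^sub>1 \<in> points Q. \<forall>g\<^sub>0 \<in> carrier G. \<forall>g\<^sub>1 \<in> carrier G.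
        A\<^sub>d (l g\<^sub>0 q\<^sub>0, l g\<^sub>1 q\<^sub>1) = g\<^sub>1 \<otimes>\<^bsub>G\<^esub> A\<^sub>d (q\<^sub>0, q\<^sub>1) \<otimes>\<^bsub>G\<^esub> inv\<^bsub>G\<^esub> g\<^sub>0) \<and>
     (\<forall>q \<in> points Q. A\<^sub>d (q, l (\<gamma> q) q) = \<one>\<^bsub>G\<^esub>)"

section \<open>Forced discrete mechanical systems\<close>

definition forced_discrete_system ::
  "('q, 'e::model_space) manifold \<Rightarrow> ('q \<times> 'q \<Rightarrow> real) \<Rightarrow> ('q \<times> 'q \<Rightarrow> 'e \<times> 'e \<Rightarrow> real) \<Rightarrow> bool" where
  "forced_discrete_system Q L f \<longleftrightarrow>
     smooth_manifold Q \<and> smooth_map (Q \<times>\<^sub>m Q) vector_manifold L \<and> one_form (Q \<times>\<^sub>m Q) f"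

definition trajectory ::
  "('q, 'e::model_space) manifold \<Rightarrow> ('q \<times> 'q \<Rightarrow> real) \<Rightarrow> ('q \<times> 'q \<Rightarrow> 'e \<times> 'e \<Rightarrow> real)
    \<Rightarrow> nat \<Rightarrow> (nat \<Rightarrow> 'q) \<Rightarrow> bool" where
  "trajectory Q L f N q \<longleftrightarrow> (\<forall>k \<in> {0..N}. q k \<in> points Q) \<and>
     (\<forall>\<delta>q :: nat \<Rightarrow> 'e. \<delta>q 0 = 0 \<and> \<delta>q N = 0 \<longrightarrow>
        (\<Sum>k<N. differential (Q \<times>\<^sub>m Q) L (q k, q (k + 1)) (\<delta>q k, \<delta>q (k + 1))) +
        (\<Sum>k<N. f (q k, q (k + 1)) (\<delta>q k, \<delta>q (k + 1))) = 0)"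

definition symmetry_group ::
  "('g, 'h::model_space) lie_grp \<Rightarrow> ('q, 'e::model_space) manifold \<Rightarrow> ('q set, 'b::model_space) manifold
    \<Rightarrow> ('g \<Rightarrow> 'q \<Rightarrow> 'q) \<Rightarrow> ('q \<times> 'q \<Rightarrow> real) \<Rightarrow> ('q \<times> 'q \<Rightarrow> 'e \<times> 'e \<Rightarrow> real) \<Rightarrow> bool" where
  "symmetry_group G Q B l L f \<longleftrightarrow> principal_bundle G Q B l \<and>
     (\<forall>g \<in> carrier G. \<forall>p \<in> points (Q \<times>\<^sub>m Q).
        L (map_prod (l g) (l g) p) = L p \<and>
        (\<forall>v. pullback (Q \<times>\<^sub>m Q) (Q \<times>\<^sub>m Q) (map_prod (l g) (l g)) f p v = f p v))"

section \<open>The reduced space and the reduced equations\<close>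

definition conj_action :: "('g, 'h) lie_grp \<Rightarrow> ('g \<Rightarrow> 'q \<Rightarrow> 'q) \<Rightarrow> 'g \<Rightarrow> 'q \<times> 'g \<Rightarrow> 'q \<times> 'g" where
  "conj_action G l g = map_prod (l g) (conjugation G g)"

text \<open>The set \<open>(Q \<times> G)/G\<close>, the quotient map \<open>\<rho>\<close>, and the projection from \<open>(Q \<times> G)/G\<close> to \<open>Q/G\<close>.\<close>

definition conj_bundle ::
  "('g, 'h) lie_grp \<Rightarrow> ('q, 'e) manifold \<Rightarrow> ('g \<Rightarrow> 'q \<Rightarrow> 'q) \<Rightarrow> ('q \<times> 'g) set set" where
  "conj_bundle G Q l = orbits G (points Q \<times> carrier G) (conj_action G l)"

definition conj_quot :: "('g, 'h) lie_grp \<Rightarrow> ('g \<Rightarrow> 'q \<Rightarrow> 'q) \<Rightarrow> 'q \<times> 'g \<Rightarrow> ('q \<times> 'g) set" where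
  "conj_quot G l = orbit G (conj_action G l)"

definition conj_proj ::
  "('g, 'h) lie_grp \<Rightarrow> ('q, 'e) manifold \<Rightarrow> ('g \<Rightarrow> 'q \<Rightarrow> 'q) \<Rightarrow> ('q \<times> 'g) set \<Rightarrow> 'q set" where
  "conj_proj G Q l v =
     (THE b. \<exists>q \<in> points Q. \<exists>g \<in> carrier G. v = conj_quot G l (q, g) \<and> b = orbit G l q)"

definition Upsilon ::
  "('g, 'h) lie_grp \<Rightarrow> ('g \<Rightarrow> 'q \<Rightarrow> 'q) \<Rightarrow> ('q \<times> 'q \<Rightarrow> 'g) \<Rightarrow> 'q \<times> 'q \<Rightarrow> ('q \<times> 'g) set \<times> 'q set" where
  "Upsilon G l A\<^sub>d = (\<lambda>(q\<^sub>0, q\<^sub>1). (conj_quot G l (q\<^sub>0, A\<^sub>d (q\<^sub>0, q\<^sub>1)), orbit G l q\<^sub>1))"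

definition Phi_tilde ::
  "('g, 'h) lie_grp \<Rightarrow> ('g \<Rightarrow> 'q \<Rightarrow> 'q) \<Rightarrow> ('q \<times> 'q \<Rightarrow> 'g) \<Rightarrow> 'q \<times> 'q \<Rightarrow> 'q \<times> 'g \<times> 'q set" where
  "Phi_tilde G l A\<^sub>d = (\<lambda>(q\<^sub>0, q\<^sub>1). (q\<^sub>0, A\<^sub>d (q\<^sub>0, q\<^sub>1), orbit G l q\<^sub>1))"

definition Psi_tilde ::
  "('g, 'h) lie_grp \<Rightarrow> ('q, 'e) manifold \<Rightarrow> ('g \<Rightarrow> 'q \<Rightarrow> 'q) \<Rightarrow> ('q \<times> 'q \<Rightarrow> 'g)
    \<Rightarrow> 'q \<times> 'g \<times> 'q set \<Rightarrow> 'q \<times> 'q" where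
  "Psi_tilde G Q l A\<^sub>d = inv_into (points Q \<times> points Q) (Phi_tilde G l A\<^sub>d)"

definition L_check ::
  "('g, 'h) lie_grp \<Rightarrow> ('q, 'e) manifold \<Rightarrow> ('g \<Rightarrow> 'q \<Rightarrow> 'q) \<Rightarrow> ('q \<times> 'q \<Rightarrow> 'g)
    \<Rightarrow> ('q \<times> 'q \<Rightarrow> real) \<Rightarrow> 'q \<times> 'g \<times> 'q set \<Rightarrow> real" where
  "L_check G Q l A\<^sub>d L = L \<circ> Psi_tilde G Q l A\<^sub>d"

definition f_check ::
  "('g, 'h::model_space) lie_grp \<Rightarrow> ('q, 'e::model_space) manifold \<Rightarrow> ('q set, 'b::model_space) manifold
    \<Rightarrow> ('g \<Rightarrow> 'q \<Rightarrow> 'q) \<Rightarrow> ('q \<times> 'q \<Rightarrow> 'g) \<Rightarrow> ('q \<times> 'q \<Rightarrow> 'e \<times> 'e \<Rightarrow> real)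
    \<Rightarrow> 'q \<times> 'g \<times> 'q set \<Rightarrow> 'e \<times> 'h \<times> 'b \<Rightarrow> real" where
  "f_check G Q B l A\<^sub>d f = pullback (Q \<times>\<^sub>m mfd G \<times>\<^sub>m B) (Q \<times>\<^sub>m Q) (Psi_tilde G Q l A\<^sub>d) f"

text \<open>
  The restriction of a linear map to the factors of its domain; applied to a tangent map of a map
  on a product of manifolds, this is the corresponding partial derivative.
\<close>

abbreviation fst_of_2 :: "('e::zero \<times> 'f::zero \<Rightarrow> 'v) \<Rightarrow> 'e \<Rightarrow> 'v" where
  "fst_of_2 \<alpha> \<equiv> (\<lambda>u. \<alpha> (u, 0))"

abbreviation snd_of_2 :: "('e::zero \<times> 'f::zero \<Rightarrow> 'v) \<Rightarrow> 'f \<Rightarrow> 'v" where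
  "snd_of_2 \<alpha> \<equiv> (\<lambda>u. \<alpha> (0, u))"

abbreviation fst_of_3 :: "('e::zero \<times> 'f::zero \<times> 'g::zero \<Rightarrow> 'v) \<Rightarrow> 'e \<Rightarrow> 'v" where
  "fst_of_3 \<alpha> \<equiv> (\<lambda>u. \<alpha> (u, 0, 0))"

abbreviation snd_of_3 :: "('e::zero \<times> 'f::zero \<times> 'g::zero \<Rightarrow> 'v) \<Rightarrow> 'f \<Rightarrow> 'v" where
  "snd_of_3 \<alpha> \<equiv> (\<lambda>u. \<alpha> (0, u, 0))"

abbreviation trd_of_3 :: "('e::zero \<times> 'f::zero \<times> 'g::zero \<Rightarrow> 'v) \<Rightarrow> 'g \<Rightarrow> 'v" where
  "trd_of_3 \<alpha> \<equiv> (\<lambda>u. \<alpha> (0, 0, u))"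

text \<open>
  \<open>dL k\<close> and \<open>f' k\<close> are the differential of \<^const>\<open>L_check\<close> and the form \<^const>\<open>f_check\<close> at
  \<open>(q\<^sub>k, w\<^sub>k, \<tau>\<^bsub>k+1\<^esub>)\<close>, with \<open>w\<^sub>k = A\<^sub>d (q\<^sub>k, q\<^bsub>k+1\<^esub>)\<close>; \<open>dA k\<close> is the tangent map of \<open>A\<^sub>d\<close> at
  \<open>(q\<^sub>k, q\<^bsub>k+1\<^esub>)\<close>.
\<close>

definition phi_fd ::
  "('g, 'h::model_space) lie_grp \<Rightarrow> ('q, 'e::model_space) manifold \<Rightarrow> ('q set, 'b::model_space) manifold
    \<Rightarrow> ('g \<Rightarrow> 'q \<Rightarrow> 'q) \<Rightarrow> ('q \<times> 'q \<Rightarrow> 'g) \<Rightarrow> ('q \<Rightarrow> 'e \<Rightarrow> 'h)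
    \<Rightarrow> ('q \<times> 'q \<Rightarrow> real) \<Rightarrow> ('q \<times> 'q \<Rightarrow> 'e \<times> 'e \<Rightarrow> real)
    \<Rightarrow> (nat \<Rightarrow> 'q) \<Rightarrow> (nat \<Rightarrow> 'q set) \<Rightarrow> nat \<Rightarrow> 'b \<Rightarrow> real" where
  "phi_fd G Q B l A\<^sub>d \<AA> L f q \<tau> k u =
    (let w = (\<lambda>j. A\<^sub>d (q j, q (j + 1)));
         dL = (\<lambda>j. differential (Q \<times>\<^sub>m mfd G \<times>\<^sub>m B) (L_check G Q l A\<^sub>d L) (q j, w j, \<tau> (j + 1)));
         f' = (\<lambda>j. f_check G Q B l A\<^sub>d f (q j, w j, \<tau> (j + 1)));
         dA = (\<lambda>j. tangent_map (Q \<times>\<^sub>m Q) (mfd G) A\<^sub>d (q j, q (j + 1)));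
         h = horizontal_lift G Q B l \<AA> (q k)
     in fst_of_3 (dL k) (h u) + trd_of_3 (dL (k - 1)) u
      + snd_of_3 (dL k) (fst_of_2 (dA k) (h u))
      + snd_of_3 (dL (k - 1)) (snd_of_2 (dA (k - 1)) (h u))
      + fst_of_3 (f' k) (h u) + trd_of_3 (f' (k - 1)) u
      + snd_of_3 (f' k) (fst_of_2 (dA k) (h u))
      + snd_of_3 (f' (k - 1)) (snd_of_2 (dA (k - 1)) (h u)))"

definition psi_fd ::
  "('g, 'h::model_space) lie_grp \<Rightarrow> ('q, 'e::model_space) manifold \<Rightarrow> ('q set, 'b::model_space) manifold
    \<Rightarrow> ('g \<Rightarrow> 'q \<Rightarrow> 'q) \<Rightarrow> ('q \<times> 'q \<Rightarrow> 'g)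
    \<Rightarrow> ('q \<times> 'q \<Rightarrow> real) \<Rightarrow> ('q \<times> 'q \<Rightarrow> 'e \<times> 'e \<Rightarrow> real)
    \<Rightarrow> (nat \<Rightarrow> 'q) \<Rightarrow> (nat \<Rightarrow> 'q set) \<Rightarrow> nat \<Rightarrow> 'h \<Rightarrow> real" where
  "psi_fd G Q B l A\<^sub>d L f q \<tau> k \<xi> =
    (let w = (\<lambda>j. A\<^sub>d (q j, q (j + 1)));
         dL = (\<lambda>j. differential (Q \<times>\<^sub>m mfd G \<times>\<^sub>m B) (L_check G Q l A\<^sub>d L) (q j, w j, \<tau> (j + 1)));
         f' = (\<lambda>j. f_check G Q B l A\<^sub>d f (q j, w j, \<tau> (j + 1)));
         dA = (\<lambda>j. tangent_map (Q \<times>\<^sub>m Q) (mfd G) A\<^sub>d (q j, q (j + 1)));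
         \<xi>\<^sub>Q = infinitesimal_generator G Q l \<xi> (q k)
     in (right_translate_covector G (w (k - 1)) (snd_of_3 (dL (k - 1))) \<xi>
         - right_translate_covector G (w k) (snd_of_3 (dL k)) \<xi>)
      + (fst_of_3 (f' k) \<xi>\<^sub>Q + snd_of_3 (f' k) (fst_of_2 (dA k) \<xi>\<^sub>Q)
         + snd_of_3 (f' (k - 1)) (snd_of_2 (dA (k - 1)) \<xi>\<^sub>Q)))"

text \<open>
  Curves indexed by \<open>{0..N}\<close> are extensional functions, so that equality of such functions is
  equality of curves.
\<close>

definition lifted_curve ::
  "('g, 'h) lie_grp \<Rightarrow> ('q, 'e) manifold \<Rightarrow> ('g \<Rightarrow> 'q \<Rightarrow> 'q) \<Rightarrow> ('q \<times> 'q \<Rightarrow> 'g) \<Rightarrow> nat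
    \<Rightarrow> (nat \<Rightarrow> ('q \<times> 'g) set) \<Rightarrow> (nat \<Rightarrow> 'q set) \<Rightarrow> 'q \<Rightarrow> (nat \<Rightarrow> 'q) \<Rightarrow> bool" where
  "lifted_curve G Q l A\<^sub>d N v \<tau> q\<^sub>0 q \<longleftrightarrow> q \<in> {0..N} \<rightarrow>\<^sub>E points Q \<and> q 0 = q\<^sub>0 \<and>
     (\<forall>k<N. Upsilon G l A\<^sub>d (q k, q (k + 1)) = (v k, \<tau> (k + 1)))"

end

theory Submission
  imports Defs
begin

text \<open>
  \<^bold>\<open>Lifting.\<close> By equivariance, \<open>A\<^sub>d (p, -)\<close> identifies each orbit with the group, and the action is
  free. A class in \<open>(Q \<times> G)/G\<close> lying over the orbit of \<open>p\<close> is therefore the same as an element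
  \<open>w\<close> of the group, and a given orbit contains exactly one \<open>q\<close> with \<open>A\<^sub>d (p, q) = w\<close>
  (\<open>Upsilon_lift\<close>). Hence \<open>q\<^sub>0\<close> and the reduced curve determine \<open>q\<^sub>1\<close>, then \<open>q\<^sub>2\<close>, and so on.

  \<^bold>\<open>Equations of motion.\<close> Summation by parts turns the variational principle into one equation for
  each interior vertex \<open>q\<^sub>k\<close>: the covector
  \<open>D\<^sub>1L(q\<^sub>k, q\<^bsub>k+1\<^esub>) + D\<^sub>2L(q\<^bsub>k-1\<^esub>, q\<^sub>k)\<close>, plus the corresponding components of the force, vanishes on
  \<open>T\<^bsub>q\<^sub>k\<^esub>Q\<close> (\<open>trajectory_if_euler_lagrange\<close>). The principal connection splits \<open>T\<^bsub>q\<^sub>k\<^esub>Q\<close> into horizontal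
  lifts and infinitesimal generators. Substituting \<open>L = L_check \<circ> \<Phi>\<close> and the analogous
  formula for the force, the chain rule gives \<open>\<phi>\<close> on the horizontal vectors
  (\<open>phi_fd_eq_euler_lagrange\<close>) and \<open>\<psi>\<close> on the vertical ones (\<open>psi_fd_eq_euler_lagrange\<close>). The
  second computation is Noether's: invariance of \<open>L\<close> exchanges its derivative along a
  generator in the first argument for minus the one in the second argument, and \<open>TA\<^sub>d\<close> maps the
  generator of \<open>\<xi>\<close> in the second argument to the right translate of \<open>\<xi>\<close>, which is the source of the
  momenta \<open>D\<^sub>2L_check w\<^sup>-\<^sup>1\<close>.

  \<^bold>\<open>What the calculus requires.\<close> Except for the smoothness of rescaled one-parameter
  subgroups, only first derivatives at single points occur. Three facts are not formal. The inverse \<open>\<Psi>\<close> of \<open>\<Phi>\<close> is differentiable (\<open>differentiable_at_\<Psi>\<close>), by an explicit formula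
  in terms of a local section. The kernel of \<open>T\<pi>\<close> consists of the generators
  (\<open>proj_zero_imp_vertical\<close>), because near \<open>q\<close> every point is the product of a group element and a point
  of the section, both depending differentiably on it. Finally, the generators, which are defined by \<open>exp\<close>, are
  the derivatives of the orbit maps (\<open>infinitesimal_generator_eq_vertical\<close>). One-parameter subgroups are
  unique by an elementary argument, and they exist because a principal connection does.
\<close>

section \<open>Tangent maps at a point\<close>

abbreviation chart_dom :: "('a, 'e) manifold \<Rightarrow> 'a \<Rightarrow> 'a set" where
  "chart_dom M p \<equiv> fst (chart_at M p)"

abbreviation coord :: "('a, 'e) manifold \<Rightarrow> 'a \<Rightarrow> 'a \<Rightarrow> 'e" where
  "coord M p \<equiv> snd (chart_at M p)"

abbreviation param :: "('a, 'e) manifold \<Rightarrow> 'a \<Rightarrow> 'e \<Rightarrow> 'a" where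
  "param M p \<equiv> chart_inv (chart_at M p)"

text \<open>
  The part of the manifold axioms that first-order calculus at a point uses. Unlike
  \<^const>\<open>smooth_manifold\<close> it passes to products with hardly any work.
\<close>

definition charted :: "('a, 'e::model_space) manifold \<Rightarrow> bool" where
  "charted M \<longleftrightarrow> (\<forall>p \<in> points M.
     chart_at M p \<in> atlas M \<and> p \<in> chart_dom M p \<and> openin (mtop M) (chart_dom M p) \<and>
     inj_on (coord M p) (chart_dom M p) \<and>
     (\<forall>W. openin (mtop M) W \<and> W \<subseteq> chart_dom M p \<longrightarrow> open (coord M p ` W)))"

lemma chartedD:
  assumes "charted M" "p \<in> points M"
  shows "chart_at M p \<in> atlas M" "p \<in> chart_dom M p" "openin (mtop M) (chart_dom M p)"
    "inj_on (coord M p) (chart_dom M p)"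
    "\<And>W. openin (mtop M) W \<Longrightarrow> W \<subseteq> chart_dom M p \<Longrightarrow> open (coord M p ` W)"
  using assms unfolding charted_def by blast+

lemma smooth_manifold_imp_charted:
  assumes "smooth_manifold M"
  shows "charted M"
  unfolding charted_def
proof
  fix p assume p: "p \<in> points M"
  let ?U = "chart_dom M p" and ?\<phi> = "coord M p"
  have c: "chart_at M p \<in> atlas M" "p \<in> ?U"
    using assms p unfolding smooth_manifold_def by blast+
  have "\<forall>(U, \<phi>) \<in> atlas M. openin (mtop M) U \<and> open (\<phi> ` U) \<and>
      homeomorphic_map (subtopology (mtop M) U) (top_of_set (\<phi> ` U)) \<phi>"
    using assms unfolding smooth_manifold_def by blast
  from bspec[OF this c(1)] have U: "openin (mtop M) ?U" "open (?\<phi> ` ?U)"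
    and hom: "homeomorphic_map (subtopology (mtop M) ?U) (top_of_set (?\<phi> ` ?U)) ?\<phi>"
    by (simp_all add: case_prod_beta)
  have top: "topspace (subtopology (mtop M) ?U) = ?U"
    using openin_subset[OF U(1)] by auto
  have "inj_on ?\<phi> ?U"
    using homeomorphic_imp_injective_map[OF hom] top by simp
  moreover have "open (?\<phi> ` W)" if "openin (mtop M) W" "W \<subseteq> ?U" for W
  proof -
    have "openin (subtopology (mtop M) ?U) W"
      using that by (simp add: openin_open_subtopology U(1))
    then have "openin (top_of_set (?\<phi> ` ?U)) (?\<phi> ` W)"
      using homeomorphic_imp_open_map[OF hom] by (simp add: open_map_def)
    then show ?thesis using U(2) by (simp add: openin_open_eq)
  qed
  ultimately show "chart_at M p \<in> atlas M \<and> p \<in> ?U \<and> openin (mtop M) ?U \<and> inj_on ?\<phi> ?U \<and>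
      (\<forall>W. openin (mtop M) W \<and> W \<subseteq> ?U \<longrightarrow> open (?\<phi> ` W))"
    using c U by blast
qed

lemma charted_vector_manifold [simp]: "charted (vector_manifold :: ('e::model_space, 'e) manifold)"
  by (auto simp: charted_def vector_manifold_def)

lemma charted_prod_manifold:
  assumes M: "charted M" and N: "charted N"
  shows "charted (M \<times>\<^sub>m N)"
  unfolding charted_def
proof
  fix x assume "x \<in> points (M \<times>\<^sub>m N)"
  then obtain p q where x: "x = (p, q)" and p: "p \<in> points M" and q: "q \<in> points N"
    by (auto simp: prod_manifold_def)
  note P = chartedD[OF M p] and Q = chartedD[OF N q]
  let ?f = "map_prod (coord M p) (coord N q)"
  have ch: "chart_at (M \<times>\<^sub>m N) x = (chart_dom M p \<times> chart_dom N q, ?f)"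
    and mt: "mtop (M \<times>\<^sub>m N) = prod_topology (mtop M) (mtop N)"
    by (simp_all add: x prod_manifold_def prod_chart_def)
  have "prod_chart (chart_at M p) (chart_at N q) \<in> atlas (M \<times>\<^sub>m N)"
    using P(1) Q(1) unfolding prod_manifold_def by (simp del: split_paired_Ex) blast
  then have at: "(chart_dom M p \<times> chart_dom N q, ?f) \<in> atlas (M \<times>\<^sub>m N)"
    by (simp add: prod_chart_def)
  have inj: "inj_on ?f (chart_dom M p \<times> chart_dom N q)"
    using P(4) Q(4) by (rule map_prod_inj_on)
  have "open (?f ` W)"
    if W: "openin (prod_topology (mtop M) (mtop N)) W" "W \<subseteq> chart_dom M p \<times> chart_dom N q" for W
  proof (rule Topological_Spaces.openI)
    fix z assume "z \<in> ?f ` W"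
    then obtain a b where ab: "(a, b) \<in> W" "z = (coord M p a, coord N q b)" by auto
    obtain U V where UV: "openin (mtop M) U" "openin (mtop N) V" "a \<in> U" "b \<in> V" "U \<times> V \<subseteq> W"
      using W(1) ab(1) unfolding openin_prod_topology_alt by meson
    have "U \<subseteq> chart_dom M p" "V \<subseteq> chart_dom N q"
      using UV(3-5) W(2) by blast+
    then have "open (coord M p ` U)" "open (coord N q ` V)"
      using P(5) Q(5) UV by blast+
    then have "open ((coord M p ` U) \<times> (coord N q ` V))" by (rule open_Times)
    moreover have "z \<in> (coord M p ` U) \<times> (coord N q ` V)" using ab UV by auto
    moreover have "(coord M p ` U) \<times> (coord N q ` V) \<subseteq> ?f ` W"
      using image_mono[OF UV(5), of ?f] unfolding map_prod_surj_on[OF refl refl] .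
    ultimately show "\<exists>T. open T \<and> z \<in> T \<and> T \<subseteq> ?f ` W" by blast
  qed
  moreover have "openin (prod_topology (mtop M) (mtop N)) (chart_dom M p \<times> chart_dom N q)"
    using P(3) Q(3) by (simp add: openin_prod_Times_iff)
  ultimately show "chart_at (M \<times>\<^sub>m N) x \<in> atlas (M \<times>\<^sub>m N) \<and> x \<in> chart_dom (M \<times>\<^sub>m N) x \<and>
      openin (mtop (M \<times>\<^sub>m N)) (chart_dom (M \<times>\<^sub>m N) x) \<and>
      inj_on (coord (M \<times>\<^sub>m N) x) (chart_dom (M \<times>\<^sub>m N) x) \<and>
      (\<forall>W. openin (mtop (M \<times>\<^sub>m N)) W \<and> W \<subseteq> chart_dom (M \<times>\<^sub>m N) x \<longrightarrow>
        open (coord (M \<times>\<^sub>m N) x ` W))"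
    unfolding ch using P(1,2) Q(1,2) inj at by (simp add: x mt)
qed

lemma charted_open_submanifold:
  assumes M: "charted M" and U: "openin (mtop M) U"
  shows "charted (open_submanifold M U)"
  unfolding charted_def
proof
  fix p assume "p \<in> points (open_submanifold M U)"
  then have p: "p \<in> points M" "p \<in> U" by (auto simp: open_submanifold_def)
  note P = chartedD[OF M p(1)]
  have ch: "chart_at (open_submanifold M U) p = (chart_dom M p \<inter> U, coord M p)"
    and mt: "mtop (open_submanifold M U) = subtopology (mtop M) U"
    by (simp_all add: open_submanifold_def)
  have at: "(chart_dom M p \<inter> U, coord M p) \<in> atlas (open_submanifold M U)"
    using P(1) unfolding open_submanifold_def by (simp del: split_paired_Ex) blast
  show "chart_at (open_submanifold M U) p \<in> atlas (open_submanifold M U) \<and>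
      p \<in> chart_dom (open_submanifold M U) p \<and>
      openin (mtop (open_submanifold M U)) (chart_dom (open_submanifold M U) p) \<and>
      inj_on (coord (open_submanifold M U) p) (chart_dom (open_submanifold M U) p) \<and>
      (\<forall>W. openin (mtop (open_submanifold M U)) W \<and> W \<subseteq> chart_dom (open_submanifold M U) p \<longrightarrow>
        open (coord (open_submanifold M U) p ` W))"
    unfolding ch mt using P p U at
    by (simp add: openin_open_subtopology inj_on_Int openin_Int)
qed

lemma points_prod [simp]: "points (M \<times>\<^sub>m N) = points M \<times> points N"
  by (simp add: prod_manifold_def)

lemma points_vector_manifold [simp]: "points vector_manifold = UNIV"
  by (simp add: vector_manifold_def)

lemma points_open_submanifold [simp]: "points (open_submanifold M U) = points M \<inter> U"
  by (simp add: open_submanifold_def)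

lemma param_coord:
  assumes "charted M" "p \<in> points M" "x \<in> chart_dom M p"
  shows "param M p (coord M p x) = x"
  using chartedD(4)[OF assms(1,2)] assms(3) by (simp add: chart_inv_def inv_into_f_f)

text \<open>
  Charts are open maps, so points with coordinates near those of \<open>p\<close> are near \<open>p\<close>. This is
  what makes formulas in coordinates valid on a neighbourhood.
\<close>

lemma eventually_param:
  assumes M: "charted M" and W: "openin (mtop M) W" "p \<in> W"
  shows "\<forall>\<^sub>F x in nhds (coord M p p).
    param M p x \<in> W \<and> param M p x \<in> chart_dom M p \<and> coord M p (param M p x) = x"
proof -
  have p: "p \<in> points M" using W openin_subset by blast
  note P = chartedD[OF M p]
  have "open (coord M p ` (W \<inter> chart_dom M p))"
    using P W by (intro P(5)) auto
  moreover have "coord M p p \<in> coord M p ` (W \<inter> chart_dom M p)"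
    using P W by blast
  ultimately have "\<forall>\<^sub>F x in nhds (coord M p p). x \<in> coord M p ` (W \<inter> chart_dom M p)"
    by (rule eventually_nhds_in_open)
  then show ?thesis
    by (rule eventually_mono) (auto simp: param_coord[OF M p])
qed

lemma has_derivative_nhds_cong:
  assumes "(f has_derivative D) (at x)" "\<forall>\<^sub>F y in nhds x. f y = g y"
  shows "(g has_derivative D) (at x)"
proof (rule has_derivative_transform_eventually[OF assms(1)])
  show "\<forall>\<^sub>F y in at x. f y = g y"
    using assms(2) by (simp add: eventually_nhds_conv_at)
qed (use eventually_nhds_x_imp_x[OF assms(2)] in simp_all)

text \<open>
  In contrast to \<^const>\<open>topcontinuous_at\<close>, nothing is required of the values at distant
  points, so that the notion only depends on the germ of \<open>f\<close> at \<open>x\<close>.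
\<close>

definition locally_continuous_at :: "'a topology \<Rightarrow> 'b topology \<Rightarrow> ('a \<Rightarrow> 'b) \<Rightarrow> 'a \<Rightarrow> bool" where
  "locally_continuous_at X Y f x \<longleftrightarrow> x \<in> topspace X \<and> f x \<in> topspace Y \<and>
     (\<forall>V. openin Y V \<and> f x \<in> V \<longrightarrow> (\<exists>U. openin X U \<and> x \<in> U \<and> (\<forall>y \<in> U. f y \<in> V)))"

lemma continuous_map_locally_continuous_at:
  assumes "continuous_map X Y f" "x \<in> topspace X"
  shows "locally_continuous_at X Y f x"
  using assms
  by (auto simp: continuous_map_eq_topcontinuous_at topcontinuous_at_def locally_continuous_at_def)

text \<open>
  Differentiability at a single point, in the charts that represent the tangent spaces. Continuity
  at the point is part of the notion: it keeps the values in the chart of the target.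
\<close>

definition has_tangent_map ::
  "('a, 'e::model_space) manifold \<Rightarrow> ('b, 'f::model_space) manifold \<Rightarrow> ('a \<Rightarrow> 'b) \<Rightarrow> 'a
    \<Rightarrow> ('e \<Rightarrow> 'f) \<Rightarrow> bool" where
  "has_tangent_map M N F p D \<longleftrightarrow> locally_continuous_at (mtop M) (mtop N) F p \<and>
     ((coord N (F p) \<circ> F \<circ> param M p) has_derivative D) (at (coord M p p))"

lemma has_tangent_map_points:
  "has_tangent_map M N F p D \<Longrightarrow> p \<in> points M"
  "has_tangent_map M N F p D \<Longrightarrow> F p \<in> points N"
  by (auto simp: has_tangent_map_def locally_continuous_at_def)

lemma tangent_map_eq: "has_tangent_map M N F p D \<Longrightarrow> tangent_map M N F p = D"
  unfolding has_tangent_map_def tangent_map_def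
  by (metis frechet_derivative_at)

lemma has_tangent_map_unique:
  "has_tangent_map M N F p D \<Longrightarrow> has_tangent_map M N F p D' \<Longrightarrow> D = D'"
  using tangent_map_eq by metis

lemma has_tangent_map_linear: "has_tangent_map M N F p D \<Longrightarrow> linear D"
  unfolding has_tangent_map_def using has_derivative_linear by blast

lemma smooth_map_has_tangent_map:
  assumes M: "charted M" and N: "charted N" and F: "smooth_map M N F" and p: "p \<in> points M"
  shows "has_tangent_map M N F p (tangent_map M N F p)"
proof -
  have c: "continuous_map (mtop M) (mtop N) F" using F by (simp add: smooth_map_def)
  then have Fp: "F p \<in> points N" using p by (auto simp: continuous_map_def)
  have "smooth_on (coord M p ` {x \<in> chart_dom M p. F x \<in> chart_dom N (F p)})
      (coord N (F p) \<circ> F \<circ> param M p)"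
    using F chartedD(1)[OF M p] chartedD(1)[OF N Fp] unfolding smooth_map_def by blast
  then have "higher_differentiable_on (Suc 0)
      (coord M p ` {x \<in> chart_dom M p. F x \<in> chart_dom N (F p)})
      (coord N (F p) \<circ> F \<circ> param M p)"
    unfolding smooth_on_def by blast
  then have "(coord N (F p) \<circ> F \<circ> param M p) differentiable (at (coord M p p))"
    using chartedD(2)[OF M p] chartedD(2)[OF N Fp] by auto
  then show ?thesis
    using c p unfolding has_tangent_map_def tangent_map_def
    by (simp add: frechet_derivative_works continuous_map_locally_continuous_at)
qed

lemma has_tangent_map_compose:
  assumes M: "charted M" and N: "charted N"
    and F: "has_tangent_map M N F p D" and H: "has_tangent_map N P H (F p) E"
  shows "has_tangent_map M P (\<lambda>x. H (F x)) p (\<lambda>v. E (D v))"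
proof -
  note pt = has_tangent_map_points[OF F]
  have cF: "locally_continuous_at (mtop M) (mtop N) F p" and cH: "locally_continuous_at (mtop N) (mtop P) H (F p)"
    using F H by (auto simp: has_tangent_map_def)
  have c: "locally_continuous_at (mtop M) (mtop P) (\<lambda>x. H (F x)) p"
    unfolding locally_continuous_at_def
  proof (intro conjI allI impI)
    fix V assume "openin (mtop P) V \<and> H (F p) \<in> V"
    then obtain W where W: "openin (mtop N) W" "F p \<in> W" "\<forall>y\<in>W. H y \<in> V"
      using cH by (auto simp: locally_continuous_at_def)
    then obtain U where "openin (mtop M) U" "p \<in> U" "\<forall>x\<in>U. F x \<in> W"
      using cF by (auto simp: locally_continuous_at_def)
    then show "\<exists>U. openin (mtop M) U \<and> p \<in> U \<and> (\<forall>x\<in>U. H (F x) \<in> V)"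
      using W by blast
  qed (use pt has_tangent_map_points[OF H] in auto)
  let ?f = "coord N (F p) \<circ> F \<circ> param M p" and ?g = "coord P (H (F p)) \<circ> H \<circ> param N (F p)"
  have fp: "?f (coord M p p) = coord N (F p) (F p)"
    using param_coord[OF M pt(1)] chartedD(2)[OF M pt(1)] by simp
  have "(?f has_derivative D) (at (coord M p p))"
    using F by (simp add: has_tangent_map_def)
  moreover have "(?g has_derivative E) (at (?f (coord M p p)))"
    unfolding fp using H by (simp add: has_tangent_map_def)
  ultimately have gf: "((\<lambda>x. ?g (?f x)) has_derivative (\<lambda>v. E (D v))) (at (coord M p p))"
    by (rule has_derivative_compose)
  obtain W where W: "openin (mtop M) W" "p \<in> W" "\<forall>x\<in>W. F x \<in> chart_dom N (F p)"
    using cF chartedD(2,3)[OF N pt(2)] unfolding locally_continuous_at_def by meson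
  have ev: "\<forall>\<^sub>F x in nhds (coord M p p).
      ?g (?f x) = (coord P (H (F p)) \<circ> (\<lambda>x. H (F x)) \<circ> param M p) x"
    by (rule eventually_mono[OF eventually_param[OF M W(1,2)]])
      (use W(3) in \<open>simp add: param_coord[OF N pt(2)]\<close>)
  have "((coord P (H (F p)) \<circ> (\<lambda>x. H (F x)) \<circ> param M p) has_derivative (\<lambda>v. E (D v)))
      (at (coord M p p))"
    using gf ev by (rule has_derivative_nhds_cong)
  then show ?thesis using c by (simp add: has_tangent_map_def)
qed

lemma has_tangent_map_cong:
  assumes M: "charted M" and F: "has_tangent_map M N F p D"
    and W: "openin (mtop M) W" "p \<in> W" "\<And>x. x \<in> W \<Longrightarrow> F x = F' x"
  shows "has_tangent_map M N F' p D"
proof -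
  note pt = has_tangent_map_points[OF F]
  have eq: "F' p = F p" using W by simp
  have cF: "locally_continuous_at (mtop M) (mtop N) F p" using F by (auto simp: has_tangent_map_def)
  have "locally_continuous_at (mtop M) (mtop N) F' p"
    unfolding locally_continuous_at_def
  proof (intro conjI allI impI)
    fix V assume "openin (mtop N) V \<and> F' p \<in> V"
    then obtain U where "openin (mtop M) U" "p \<in> U" "\<forall>x\<in>U. F x \<in> V"
      using cF eq by (auto simp: locally_continuous_at_def)
    then show "\<exists>U. openin (mtop M) U \<and> p \<in> U \<and> (\<forall>x\<in>U. F' x \<in> V)"
      using W by (intro exI[of _ "U \<inter> W"]) auto
  qed (use pt eq in auto)
  moreover have ev: "\<forall>\<^sub>F x in nhds (coord M p p).
      (coord N (F p) \<circ> F \<circ> param M p) x = (coord N (F' p) \<circ> F' \<circ> param M p) x"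
    by (rule eventually_mono[OF eventually_param[OF M W(1,2)]]) (use W(3) eq in simp)
  then have "((coord N (F' p) \<circ> F' \<circ> param M p) has_derivative D) (at (coord M p p))"
    using F has_derivative_nhds_cong[OF _ ev] unfolding has_tangent_map_def by blast
  ultimately show ?thesis by (simp add: has_tangent_map_def)
qed

lemma has_tangent_map_id:
  assumes M: "charted M" and p: "p \<in> points M"
  shows "has_tangent_map M M (\<lambda>x. x) p (\<lambda>v. v)"
proof -
  have ev: "\<forall>\<^sub>F x in nhds (coord M p p). x = (coord M p \<circ> (\<lambda>x. x) \<circ> param M p) x"
    by (rule eventually_mono[OF eventually_param[OF M openin_topspace p]]) simp
  have "((coord M p \<circ> (\<lambda>x. x) \<circ> param M p) has_derivative (\<lambda>v. v)) (at (coord M p p))"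
    using has_derivative_ident ev by (rule has_derivative_nhds_cong)
  then show ?thesis using p by (auto simp: has_tangent_map_def locally_continuous_at_def)
qed

lemma has_tangent_map_const:
  assumes "p \<in> points M" "c \<in> points N"
  shows "has_tangent_map M N (\<lambda>_. c) p (\<lambda>_. 0)"
  using assms by (auto simp: has_tangent_map_def locally_continuous_at_def comp_def)

lemma has_tangent_map_Pair:
  assumes F: "has_tangent_map M N F p D" and H: "has_tangent_map M P H p E"
  shows "has_tangent_map M (N \<times>\<^sub>m P) (\<lambda>x. (F x, H x)) p (\<lambda>v. (D v, E v))"
proof -
  have cF: "locally_continuous_at (mtop M) (mtop N) F p" and cH: "locally_continuous_at (mtop M) (mtop P) H p"
    using F H by (auto simp: has_tangent_map_def)
  have "locally_continuous_at (mtop M) (mtop (N \<times>\<^sub>m P)) (\<lambda>x. (F x, H x)) p"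
    unfolding locally_continuous_at_def
  proof (intro conjI allI impI)
    fix V assume V0: "openin (mtop (N \<times>\<^sub>m P)) V \<and> (F p, H p) \<in> V"
    then have "openin (prod_topology (mtop N) (mtop P)) V" by (simp add: prod_manifold_def)
    from openin_prod_topology_alt[THEN iffD1, OF this, rule_format, OF conjunct2[OF V0]] obtain V1 V2 where V: "openin (mtop N) V1" "openin (mtop P) V2" "F p \<in> V1" "H p \<in> V2" "V1 \<times> V2 \<subseteq> V"
      by blast
    obtain U1 where "openin (mtop M) U1" "p \<in> U1" "\<forall>x\<in>U1. F x \<in> V1"
      using cF V unfolding locally_continuous_at_def by blast
    moreover obtain U2 where "openin (mtop M) U2" "p \<in> U2" "\<forall>x\<in>U2. H x \<in> V2"
      using cH V unfolding locally_continuous_at_def by blast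
    ultimately show "\<exists>U. openin (mtop M) U \<and> p \<in> U \<and> (\<forall>x\<in>U. (F x, H x) \<in> V)"
      using V(5) by (intro exI[of _ "U1 \<inter> U2"]) auto
  qed (use cF cH in \<open>auto simp: locally_continuous_at_def\<close>)
  moreover have "((\<lambda>x. ((coord N (F p) \<circ> F \<circ> param M p) x, (coord P (H p) \<circ> H \<circ> param M p) x))
      has_derivative (\<lambda>v. (D v, E v))) (at (coord M p p))"
    using F H unfolding has_tangent_map_def by (intro has_derivative_Pair) blast+
  moreover have "(\<lambda>x. ((coord N (F p) \<circ> F \<circ> param M p) x, (coord P (H p) \<circ> H \<circ> param M p) x)) =
      coord (N \<times>\<^sub>m P) (F p, H p) \<circ> (\<lambda>x. (F x, H x)) \<circ> param M p"
    by (auto simp: prod_manifold_def prod_chart_def)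
  ultimately show ?thesis
    unfolding has_tangent_map_def by simp
qed

lemma
  assumes M: "charted M" and N: "charted N" and p: "p \<in> points M" and q: "q \<in> points N"
  shows has_tangent_map_fst: "has_tangent_map (M \<times>\<^sub>m N) M fst (p, q) fst"
    and has_tangent_map_snd: "has_tangent_map (M \<times>\<^sub>m N) N snd (p, q) snd"
proof -
  have c: "continuous_map (mtop (M \<times>\<^sub>m N)) (mtop M) fst" "continuous_map (mtop (M \<times>\<^sub>m N)) (mtop N) snd"
    by (auto simp: prod_manifold_def continuous_map_fst continuous_map_snd)
  have c0: "coord (M \<times>\<^sub>m N) (p, q) (p, q) = (coord M p p, coord N q q)"
    by (simp add: prod_manifold_def prod_chart_def)
  have ev: "\<forall>\<^sub>F z in nhds (coord M p p, coord N q q).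
      fst z = (coord M (fst (p, q)) \<circ> fst \<circ> param (M \<times>\<^sub>m N) (p, q)) z \<and>
      snd z = (coord N (snd (p, q)) \<circ> snd \<circ> param (M \<times>\<^sub>m N) (p, q)) z"
    by (rule eventually_mono[OF eventually_param[OF charted_prod_manifold[OF M N]
          openin_topspace, of "(p, q)", unfolded c0]])
       (use p q in \<open>auto simp: prod_manifold_def prod_chart_def\<close>)
  have "((coord M (fst (p, q)) \<circ> fst \<circ> param (M \<times>\<^sub>m N) (p, q)) has_derivative fst)
      (at (coord M p p, coord N q q))"
    by (rule has_derivative_nhds_cong[OF has_derivative_fst[OF has_derivative_ident]])
      (use ev in \<open>auto elim: eventually_mono\<close>)
  moreover have "((coord N (snd (p, q)) \<circ> snd \<circ> param (M \<times>\<^sub>m N) (p, q)) has_derivative snd)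
      (at (coord M p p, coord N q q))"
    by (rule has_derivative_nhds_cong[OF has_derivative_snd[OF has_derivative_ident]])
      (use ev in \<open>auto elim: eventually_mono\<close>)
  ultimately show "has_tangent_map (M \<times>\<^sub>m N) M fst (p, q) fst"
    "has_tangent_map (M \<times>\<^sub>m N) N snd (p, q) snd"
    using c p q by (auto simp: has_tangent_map_def c0 continuous_map_locally_continuous_at)
qed

lemma has_tangent_map_into_open_submanifold:
  assumes M: "charted M" and U: "openin (mtop M) U" and p: "p \<in> U"
  shows "has_tangent_map M (open_submanifold M U) (\<lambda>x. x) p (\<lambda>v. v)"
proof -
  have "p \<in> points M" using U p openin_subset by blast
  moreover have "coord (open_submanifold M U) p = coord M p"
    by (simp add: open_submanifold_def)
  moreover have "locally_continuous_at (mtop M) (mtop (open_submanifold M U)) (\<lambda>x. x) p"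
    using calculation(1) p U unfolding locally_continuous_at_def
    by (auto simp: open_submanifold_def openin_open_subtopology)
  ultimately show ?thesis
    using has_tangent_map_id[OF M, of p] by (simp add: has_tangent_map_def)
qed

lemma has_tangent_map_from_open_submanifold:
  assumes M: "charted M" and U: "openin (mtop M) U" and p: "p \<in> U"
  shows "has_tangent_map (open_submanifold M U) M (\<lambda>x. x) p (\<lambda>v. v)"
proof -
  have pM: "p \<in> points M" using U p openin_subset by blast
  note S = charted_open_submanifold[OF M U]
  have c: "coord (open_submanifold M U) p = coord M p"
    by (simp add: open_submanifold_def)
  have "continuous_map (subtopology (mtop M) U) (mtop M) (\<lambda>x. x)"
    by (simp add: continuous_map_from_subtopology)
  then have "locally_continuous_at (mtop (open_submanifold M U)) (mtop M) (\<lambda>x. x) p"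
    using pM p by (intro continuous_map_locally_continuous_at) (simp_all add: open_submanifold_def)
  moreover have "((coord M p \<circ> (\<lambda>x. x) \<circ> param (open_submanifold M U) p) has_derivative (\<lambda>v. v))
      (at (coord M p p))"
    using has_tangent_map_id[OF S, of p] pM p by (simp add: has_tangent_map_def c)
  ultimately show ?thesis
    by (simp add: has_tangent_map_def c)
qed

lemma has_tangent_map_partial:
  assumes M: "charted M" and N: "charted N" and F: "has_tangent_map (M \<times>\<^sub>m N) P F (a, b) D"
  shows "has_tangent_map M P (\<lambda>x. F (x, b)) a (\<lambda>u. D (u, 0))"
    and "has_tangent_map N P (\<lambda>y. F (a, y)) b (\<lambda>u. D (0, u))"
proof -
  have ab: "a \<in> points M" "b \<in> points N" using has_tangent_map_points(1)[OF F] by auto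
  note MN = charted_prod_manifold[OF M N]
  have "has_tangent_map M (M \<times>\<^sub>m N) (\<lambda>x. (x, b)) a (\<lambda>u. (u, 0))"
    by (intro has_tangent_map_Pair has_tangent_map_id has_tangent_map_const M ab)
  from has_tangent_map_compose[OF M MN this F]
  show "has_tangent_map M P (\<lambda>x. F (x, b)) a (\<lambda>u. D (u, 0))" .
  have "has_tangent_map N (M \<times>\<^sub>m N) (\<lambda>y. (a, y)) b (\<lambda>u. (0, u))"
    by (intro has_tangent_map_Pair has_tangent_map_id has_tangent_map_const N ab)
  from has_tangent_map_compose[OF N MN this F]
  show "has_tangent_map N P (\<lambda>y. F (a, y)) b (\<lambda>u. D (0, u))" .
qed

lemma vector_manifold_simps [simp]:
  "mtop vector_manifold = euclidean" "coord vector_manifold p = id" "param vector_manifold p = id"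
  by (auto simp: vector_manifold_def chart_inv_def inv_into_def fun_eq_iff)

lemma has_tangent_map_vector:
  assumes "(f has_derivative D) (at t)"
  shows "has_tangent_map vector_manifold vector_manifold f t D"
proof -
  have "isCont f t" using assms has_derivative_continuous by blast
  then have "locally_continuous_at euclidean euclidean f t"
    unfolding locally_continuous_at_def continuous_at_open by simp
  then show ?thesis using assms by (simp add: has_tangent_map_def)
qed

definition differentiable_at ::
  "('a, 'e::model_space) manifold \<Rightarrow> ('b, 'f::model_space) manifold \<Rightarrow> ('a \<Rightarrow> 'b) \<Rightarrow> 'a \<Rightarrow> bool" where
  "differentiable_at M N F p \<longleftrightarrow> (\<exists>D. has_tangent_map M N F p D)"

lemma differentiable_atI: "has_tangent_map M N F p D \<Longrightarrow> differentiable_at M N F p"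
  unfolding differentiable_at_def by (rule exI)

lemma differentiable_at_points:
  assumes "differentiable_at M N F p"
  shows "p \<in> points M" "F p \<in> points N"
proof -
  obtain D where "has_tangent_map M N F p D"
    using assms unfolding differentiable_at_def by (rule exE)
  from has_tangent_map_points[OF this] show "p \<in> points M" "F p \<in> points N" .
qed

lemma differentiable_atD:
  assumes "differentiable_at M N F p"
  shows "has_tangent_map M N F p (tangent_map M N F p)"
proof -
  obtain D where "has_tangent_map M N F p D"
    using assms unfolding differentiable_at_def by blast
  then show ?thesis by (simp add: tangent_map_eq)
qed

lemma differentiable_at_compose:
  assumes "charted M" "charted N" "differentiable_at M N F p" "differentiable_at N P H (F p)"
  shows "differentiable_at M P (\<lambda>x. H (F x)) p"
proof -
  obtain D E where "has_tangent_map M N F p D" "has_tangent_map N P H (F p) E"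
    using assms(3,4) unfolding differentiable_at_def by blast
  from has_tangent_map_compose[OF assms(1,2) this] show ?thesis by (rule differentiable_atI)
qed

lemma differentiable_at_Pair:
  assumes "differentiable_at M N F p" "differentiable_at M P H p"
  shows "differentiable_at M (N \<times>\<^sub>m P) (\<lambda>x. (F x, H x)) p"
proof -
  obtain D E where "has_tangent_map M N F p D" "has_tangent_map M P H p E"
    using assms unfolding differentiable_at_def by blast
  from has_tangent_map_Pair[OF this] show ?thesis by (rule differentiable_atI)
qed

lemma smooth_map_differentiable_at:
  assumes "charted M" "charted N" "smooth_map M N F" "p \<in> points M"
  shows "differentiable_at M N F p"
  using smooth_map_has_tangent_map[OF assms] by (rule differentiable_atI)

section \<open>One-parameter subgroups\<close>

text \<open>
  Derivatives of higher order occur for one purpose only: a one-parameter subgroup has to remain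
  smooth when its parameter is rescaled.
\<close>

lemma higher_differentiable_on_cong:
  assumes "open S" "\<And>x. x \<in> S \<Longrightarrow> f x = g x" "higher_differentiable_on n S f"
  shows "higher_differentiable_on n S g"
  using assms(2,3)
proof (induction n arbitrary: f g)
  case 0
  then show ?case using continuous_on_eq[of S f g] by simp
next
  case (Suc n)
  have D: "(g has_derivative frechet_derivative f (at x)) (at x)" if x: "x \<in> S" for x
  proof (rule has_derivative_nhds_cong)
    show "(f has_derivative frechet_derivative f (at x)) (at x)"
      using Suc.prems(2) x by (simp add: frechet_derivative_works)
    show "\<forall>\<^sub>F y in nhds x. f y = g y"
      using eventually_nhds_in_open[OF assms(1) x] Suc.prems(1) by (auto elim: eventually_mono)
  qed
  have "higher_differentiable_on n S (\<lambda>x. frechet_derivative g (at x) v)" for v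
    by (rule Suc.IH[where f = "\<lambda>x. frechet_derivative f (at x) v"])
      (use Suc.prems(2) frechet_derivative_at[OF D] in auto)
  then show ?case using D unfolding higher_differentiable_on.simps differentiable_def by blast
qed

lemma higher_differentiable_on_const: "higher_differentiable_on n S (\<lambda>_. k)"
  by (induction n arbitrary: k) (simp_all add: frechet_derivative_const)

lemma higher_differentiable_on_rescale:
  fixes f :: "real \<Rightarrow> 'b::real_normed_vector"
  assumes "open S" "higher_differentiable_on n S f"
  shows "higher_differentiable_on n {t. r * t \<in> S} (\<lambda>t. f (r * t))"
  using assms(2)
proof (induction n arbitrary: f)
  case 0
  then have "continuous_on S f" by simp
  then show ?case
    by (simp, intro continuous_on_compose2[OF _ continuous_on_mult_left[OF continuous_on_id]]) auto
next
  case (Suc n)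
  have op: "open {t. r * t \<in> S}"
    using open_vimage[OF assms(1), of "\<lambda>t. r * t"] by (simp add: vimage_def continuous_intros)
  have D: "((\<lambda>t. f (r * t)) has_derivative (\<lambda>v. frechet_derivative f (at (r * t)) (r * v))) (at t)"
    if t: "r * t \<in> S" for t
  proof (rule has_derivative_compose[where f = "\<lambda>t. r * t"])
    show "(f has_derivative frechet_derivative f (at (r * t))) (at (r * t))"
      using Suc.prems t by (simp add: frechet_derivative_works)
  qed (auto intro!: derivative_eq_intros)
  have "higher_differentiable_on n {t. r * t \<in> S} (\<lambda>t. frechet_derivative (\<lambda>t. f (r * t)) (at t) v)" for v
  proof (rule higher_differentiable_on_cong[OF op])
    show "higher_differentiable_on n {t. r * t \<in> S} (\<lambda>t. frechet_derivative f (at (r * t)) (r * v))"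
      using Suc.IH[of "\<lambda>x. frechet_derivative f (at x) (r * v)"] Suc.prems by simp
  qed (use frechet_derivative_at[OF D] in \<open>auto simp: fun_eq_iff\<close>)
  then show ?case using D unfolding higher_differentiable_on.simps differentiable_def by blast
qed

text \<open>
  The hypothesis concerns the derivative in the chart chosen at each \<open>c t\<close>. A change of charts
  transports it to one fixed chart around a given value, where the usual theorem shows that \<open>c\<close> is
  locally constant; the real line is connected.
\<close>

lemma zero_velocity_imp_constant:
  fixes c :: "real \<Rightarrow> 'a"
  assumes N: "smooth_manifold N" and c: "\<And>t. has_tangent_map vector_manifold N c t (\<lambda>_. 0)"
  shows "c s = c t"
proof (rule connected_local_const[OF connected_UNIV UNIV_I UNIV_I], intro ballI)
  fix a
  note Nc = smooth_manifold_imp_charted[OF N]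
  let ?U = "chart_dom N (c a)" and ?\<phi> = "coord N (c a)"
  have ca: "c a \<in> points N" using has_tangent_map_points(2)[OF c] .
  have "locally_continuous_at euclidean (mtop N) c a"
    using c[of a] by (simp add: has_tangent_map_def)
  moreover have "openin (mtop N) ?U \<and> c a \<in> ?U" using chartedD[OF Nc ca] by blast
  ultimately have "\<exists>S. openin euclidean S \<and> a \<in> S \<and> (\<forall>y\<in>S. c y \<in> ?U)"
    unfolding locally_continuous_at_def by blast
  then obtain S where S: "open S" "a \<in> S" "\<forall>y\<in>S. c y \<in> ?U" by auto
  then obtain e where e: "e > 0" "ball a e \<subseteq> S" by (meson openE)
  have "((\<lambda>t. ?\<phi> (c t)) has_derivative (\<lambda>_. 0)) (at t within ball a e)" if t: "t \<in> ball a e" for t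
  proof -
    let ?V = "chart_dom N (c t)" and ?\<psi> = "coord N (c t)"
    have ct: "c t \<in> points N" using has_tangent_map_points(2)[OF c] .
    note C = chartedD[OF Nc ct]
    have "smooth_on (?\<psi> ` (?V \<inter> ?U)) (?\<phi> \<circ> param N (c t))"
      using N C(1) chartedD(1)[OF Nc ca] unfolding smooth_manifold_def by blast
    then have "higher_differentiable_on (Suc 0) (?\<psi> ` (?V \<inter> ?U)) (?\<phi> \<circ> param N (c t))"
      unfolding smooth_on_def by blast
    moreover have "c t \<in> ?V \<inter> ?U" using C(2) S e t by blast
    ultimately have "(?\<phi> \<circ> param N (c t)) differentiable (at (?\<psi> (c t)))" by auto
    then obtain D where D: "((?\<phi> \<circ> param N (c t)) has_derivative D) (at (?\<psi> (c t)))"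
      unfolding differentiable_def by blast
    have "((\<lambda>s. ?\<psi> (c s)) has_derivative (\<lambda>_. 0)) (at t)"
      using c[of t] by (simp add: has_tangent_map_def comp_def)
    from has_derivative_compose[OF this D]
    have "((\<lambda>s. (?\<phi> \<circ> param N (c t)) (?\<psi> (c s))) has_derivative (\<lambda>_. 0)) (at t)"
      using linear_0[OF has_derivative_linear[OF D]] by simp
    then have der: "((\<lambda>s. (?\<phi> \<circ> param N (c t)) (?\<psi> (c s))) has_derivative (\<lambda>_. 0)) (at t)" .
    have "\<exists>S. openin euclidean S \<and> t \<in> S \<and> (\<forall>y\<in>S. c y \<in> ?V)"
      using c[of t] C(2,3) unfolding has_tangent_map_def locally_continuous_at_def by simp
    then obtain S' where S': "open S'" "t \<in> S'" "\<forall>y\<in>S'. c y \<in> ?V" by auto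
    have "\<forall>\<^sub>F s in nhds t. (?\<phi> \<circ> param N (c t)) (?\<psi> (c s)) = ?\<phi> (c s)"
      by (rule eventually_mono[OF eventually_nhds_in_open[OF S'(1,2)]])
        (use S'(3) in \<open>simp add: param_coord[OF Nc ct]\<close>)
    from has_derivative_nhds_cong[OF der this] show ?thesis
      by (rule has_derivative_at_withinI)
  qed
  then obtain k where k: "\<forall>t\<in>ball a e. ?\<phi> (c t) = k"
    using has_derivative_zero_constant[OF convex_ball] by blast
  have "c a = c b" if b: "b \<in> ball a e" for b
  proof (rule inj_onD[OF chartedD(4)[OF Nc ca]])
    show "?\<phi> (c a) = ?\<phi> (c b)" using k b e(1) by simp
  qed (use S e b in auto)
  then have "\<forall>\<^sub>F b in nhds a. c a = c b"
    using eventually_nhds_in_open[OF open_ball, of a a e] e(1)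
    by (auto elim: eventually_mono)
  then show "\<forall>\<^sub>F b in at a within UNIV. c a = c b"
    by (simp add: eventually_nhds_conv_at)
qed

lemma lie_groupD:
  assumes "lie_group G"
  shows "group G" "smooth_manifold (mfd G)" "charted (mfd G)" "points (mfd G) = carrier G"
    "smooth_map (mfd G \<times>\<^sub>m mfd G) (mfd G) (\<lambda>(g, h). g \<otimes>\<^bsub>G\<^esub> h)"
    "smooth_map (mfd G) (mfd G) (\<lambda>g. inv\<^bsub>G\<^esub> g)"
  using assms unfolding lie_group_def by (blast intro: smooth_manifold_imp_charted)+

lemma lie_group_mult_differentiable:
  assumes G: "lie_group G" and ab: "a \<in> carrier G" "b \<in> carrier G"
  obtains D where "has_tangent_map (mfd G \<times>\<^sub>m mfd G) (mfd G) (\<lambda>x. fst x \<otimes>\<^bsub>G\<^esub> snd x) (a, b) D"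
proof -
  note g = lie_groupD[OF G]
  have "(a, b) \<in> points (mfd G \<times>\<^sub>m mfd G)" using g(4) ab by simp
  from smooth_map_has_tangent_map[OF charted_prod_manifold[OF g(3) g(3)] g(3,5) this]
  show thesis unfolding case_prod_unfold by (rule that)
qed

text \<open>
  The partial maps of the multiplication at the identity are the identity map.
\<close>

lemma tangent_map_mult_at_one:
  assumes G: "lie_group G"
  shows "has_tangent_map (mfd G \<times>\<^sub>m mfd G) (mfd G) (\<lambda>x. fst x \<otimes>\<^bsub>G\<^esub> snd x) (\<one>\<^bsub>G\<^esub>, \<one>\<^bsub>G\<^esub>)
    (\<lambda>v. fst v + snd v)"
proof -
  note g = lie_groupD[OF G]
  interpret group G by (rule g(1))
  obtain D where D: "has_tangent_map (mfd G \<times>\<^sub>m mfd G) (mfd G) (\<lambda>x. fst x \<otimes>\<^bsub>G\<^esub> snd x) (\<one>\<^bsub>G\<^esub>, \<one>\<^bsub>G\<^esub>) D"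
    by (rule lie_group_mult_differentiable[OF G one_closed one_closed])
  note P = has_tangent_map_partial[OF g(3) g(3) D, unfolded fst_conv snd_conv]
  have op: "openin (mtop (mfd G)) (carrier G)"
    using openin_topspace[of "mtop (mfd G)"] g(4) by simp
  have id: "has_tangent_map (mfd G) (mfd G) (\<lambda>x. x) \<one>\<^bsub>G\<^esub> (\<lambda>v. v)"
    using has_tangent_map_id[OF g(3)] g(4) by simp
  have "has_tangent_map (mfd G) (mfd G) (\<lambda>x. x) \<one>\<^bsub>G\<^esub> (\<lambda>u. D (u, 0))"
    by (rule has_tangent_map_cong[OF g(3) P(1) op]) auto
  then have 1: "(\<lambda>u. D (u, 0)) = (\<lambda>v. v)"
    using id by (rule has_tangent_map_unique)
  have "has_tangent_map (mfd G) (mfd G) (\<lambda>x. x) \<one>\<^bsub>G\<^esub> (\<lambda>u. D (0, u))"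
    by (rule has_tangent_map_cong[OF g(3) P(2) op]) auto
  then have 2: "(\<lambda>u. D (0, u)) = (\<lambda>v. v)"
    using id by (rule has_tangent_map_unique)
  have "D v = fst v + snd v" for v
    using linear_add[OF has_tangent_map_linear[OF D], of "(fst v, 0)" "(0, snd v)"]
      fun_cong[OF 1, of "fst v"] fun_cong[OF 2, of "snd v"] by (simp del: split_paired_All)
  then have "D = (\<lambda>v. fst v + snd v)" by (rule ext)
  then show ?thesis using D by simp
qed

lemma one_parameter_subgroupD:
  assumes G: "lie_group G" and c: "one_parameter_subgroup G c"
  shows "c t \<in> carrier G" "c (s + t) = c s \<otimes>\<^bsub>G\<^esub> c t" "c 0 = \<one>\<^bsub>G\<^esub>"
    "has_tangent_map vector_manifold (mfd G) c 0 (\<lambda>r. r *\<^sub>R velocity (mfd G) c)"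
proof -
  note g = lie_groupD[OF G]
  interpret group G by (rule g(1))
  have sm: "smooth_map vector_manifold (mfd G) c" using c by (simp add: one_parameter_subgroup_def)
  show mem: "c t \<in> carrier G" for t
    using sm g(4) by (auto simp: smooth_map_def continuous_map_def)
  show add: "c (s + t) = c s \<otimes>\<^bsub>G\<^esub> c t" for s t
    using c by (simp add: one_parameter_subgroup_def)
  have "c 0 \<otimes>\<^bsub>G\<^esub> c 0 = c 0" using add[of 0 0] unfolding add_0 by (rule sym)
  then show "c 0 = \<one>\<^bsub>G\<^esub>" using mem[of 0] by simp
  have D: "has_tangent_map vector_manifold (mfd G) c 0 (tangent_map vector_manifold (mfd G) c 0)"
    by (rule smooth_map_has_tangent_map[OF _ g(3) sm]) auto
  have "tangent_map vector_manifold (mfd G) c 0 r = r *\<^sub>R velocity (mfd G) c" for r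
    using linear_scale[OF has_tangent_map_linear[OF D], of r 1] by (simp add: velocity_def)
  then have "tangent_map vector_manifold (mfd G) c 0 = (\<lambda>r. r *\<^sub>R velocity (mfd G) c)" by (rule ext)
  then show "has_tangent_map vector_manifold (mfd G) c 0 (\<lambda>r. r *\<^sub>R velocity (mfd G) c)"
    using D by simp
qed

text \<open>
  The curve \<open>e t = c (- t) \<otimes> d t\<close> has velocity \<open>- \<xi> + \<xi> = 0\<close> at \<open>0\<close>. Since \<open>e s\<close> is
  \<open>c (- t) \<otimes> e (s - t) \<otimes> d t\<close>, its velocity vanishes at every \<open>t\<close>, so \<open>e\<close> is constantly the
  identity. This argument replaces the uniqueness theorem for ordinary differential equations.
\<close>

lemma one_parameter_subgroup_unique:
  assumes G: "lie_group G"
    and c: "one_parameter_subgroup G c" and d: "one_parameter_subgroup G d"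
    and vel: "velocity (mfd G) c = velocity (mfd G) d"
  shows "c = d"
proof
  note g = lie_groupD[OF G]
  interpret group G by (rule g(1))
  note C = one_parameter_subgroupD[OF G c] and D = one_parameter_subgroupD[OF G d]
  note GG = charted_prod_manifold[OF g(3) g(3)]
  let ?e = "\<lambda>t. c (- t) \<otimes>\<^bsub>G\<^esub> d t"
  have neg: "has_tangent_map vector_manifold vector_manifold (\<lambda>t::real. - t) 0 (\<lambda>r. - r)"
    by (rule has_tangent_map_vector) (auto intro!: derivative_eq_intros)
  have "has_tangent_map vector_manifold (mfd G) c (- 0) (\<lambda>r. r *\<^sub>R velocity (mfd G) c)"
    using C(4) by simp
  from has_tangent_map_compose[OF _ _ neg this]
  have "has_tangent_map vector_manifold (mfd G) (\<lambda>t. c (- t)) 0 (\<lambda>r. - r *\<^sub>R velocity (mfd G) c)"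
    by simp
  from has_tangent_map_Pair[OF this D(4)]
  have "has_tangent_map vector_manifold (mfd G \<times>\<^sub>m mfd G) (\<lambda>t. (c (- t), d t)) 0
      (\<lambda>r. (- r *\<^sub>R velocity (mfd G) c, r *\<^sub>R velocity (mfd G) d))" .
  moreover have "has_tangent_map (mfd G \<times>\<^sub>m mfd G) (mfd G) (\<lambda>x. fst x \<otimes>\<^bsub>G\<^esub> snd x) (c (- 0), d 0)
      (\<lambda>v. fst v + snd v)"
    using tangent_map_mult_at_one[OF G] C(3) D(3) by simp
  ultimately have "has_tangent_map vector_manifold (mfd G) (\<lambda>t. fst (c (- t), d t) \<otimes>\<^bsub>G\<^esub> snd (c (- t), d t)) 0
      (\<lambda>r. fst (- r *\<^sub>R velocity (mfd G) c, r *\<^sub>R velocity (mfd G) d)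
         + snd (- r *\<^sub>R velocity (mfd G) c, r *\<^sub>R velocity (mfd G) d))"
    by (rule has_tangent_map_compose[OF charted_vector_manifold GG])
  then have e0: "has_tangent_map vector_manifold (mfd G) ?e 0 (\<lambda>_. 0)"
    by (simp add: vel)
  have "has_tangent_map vector_manifold (mfd G) ?e t (\<lambda>_. 0)" for t
  proof -
    have eq: "?e s = c (- t) \<otimes>\<^bsub>G\<^esub> (?e (s - t) \<otimes>\<^bsub>G\<^esub> d t)" for s
    proof -
      have "c (- s) = c (- t) \<otimes>\<^bsub>G\<^esub> c (- (s - t))" "d s = d (s - t) \<otimes>\<^bsub>G\<^esub> d t"
        using C(2)[of "- t" "- (s - t)"] D(2)[of "s - t" t] by simp_all
      then show ?thesis
        using C(1) D(1) by (simp only: m_assoc m_closed)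
    qed
    have shift: "has_tangent_map vector_manifold vector_manifold (\<lambda>s::real. s - t) t (\<lambda>r. r)"
      by (rule has_tangent_map_vector) (auto intro!: derivative_eq_intros)
    have "has_tangent_map vector_manifold (mfd G) ?e (t - t) (\<lambda>_. 0)" using e0 by simp
    from has_tangent_map_compose[OF _ _ shift this]
    have s: "has_tangent_map vector_manifold (mfd G) (\<lambda>s. ?e (s - t)) t (\<lambda>_. 0)" by simp
    obtain D1 where D1: "has_tangent_map (mfd G \<times>\<^sub>m mfd G) (mfd G) (\<lambda>x. fst x \<otimes>\<^bsub>G\<^esub> snd x) (?e (t - t), d t) D1"
      by (rule lie_group_mult_differentiable[OF G m_closed[OF C(1) D(1)] D(1)])
    have s1: "has_tangent_map vector_manifold (mfd G) (\<lambda>s. ?e (s - t) \<otimes>\<^bsub>G\<^esub> d t) t (\<lambda>_. D1 (0, 0))"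
      using has_tangent_map_compose[OF charted_vector_manifold g(3) s
          has_tangent_map_partial(1)[OF g(3) g(3) D1]] by simp
    obtain D2 where D2: "has_tangent_map (mfd G \<times>\<^sub>m mfd G) (mfd G) (\<lambda>x. fst x \<otimes>\<^bsub>G\<^esub> snd x)
        (c (- t), ?e (t - t) \<otimes>\<^bsub>G\<^esub> d t) D2"
      by (rule lie_group_mult_differentiable[OF G C(1) m_closed[OF m_closed[OF C(1) D(1)] D(1)]])
    have "has_tangent_map vector_manifold (mfd G) (\<lambda>s. c (- t) \<otimes>\<^bsub>G\<^esub> (?e (s - t) \<otimes>\<^bsub>G\<^esub> d t)) t
        (\<lambda>_. D2 (0, D1 (0, 0)))"
      using has_tangent_map_compose[OF charted_vector_manifold g(3) s1
          has_tangent_map_partial(2)[OF g(3) g(3) D2]] by simp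
    moreover have "D1 (0, 0) = 0" "D2 (0, 0) = 0"
      using linear_0[OF has_tangent_map_linear[OF D1]] linear_0[OF has_tangent_map_linear[OF D2]]
      by (simp_all add: zero_prod_def)
    ultimately show ?thesis unfolding eq[symmetric] by simp
  qed
  then have "?e t = ?e 0" for t
    by (rule zero_velocity_imp_constant[OF g(2)])
  then have e: "c (- t) \<otimes>\<^bsub>G\<^esub> d t = \<one>\<^bsub>G\<^esub>" for t by (simp add: C(3) D(3))
  fix t
  have "c t \<otimes>\<^bsub>G\<^esub> c (- t) = \<one>\<^bsub>G\<^esub>"
    using C(2)[of t "- t", symmetric] C(3) by simp
  then have "c t \<otimes>\<^bsub>G\<^esub> (c (- t) \<otimes>\<^bsub>G\<^esub> d t) = d t"
    using C(1) D(1) by (simp add: m_assoc[symmetric])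
  then show "c t = d t" using e C(1) by simp
qed

lemma one_parameter_subgroup_rescale:
  assumes G: "lie_group G" and c: "one_parameter_subgroup G c"
  shows "one_parameter_subgroup G (\<lambda>t. c (r * t))"
    and "velocity (mfd G) (\<lambda>t. c (r * t)) = r *\<^sub>R velocity (mfd G) c"
proof -
  note C = one_parameter_subgroupD[OF G c]
  have sm: "smooth_map vector_manifold (mfd G) c" using c by (simp add: one_parameter_subgroup_def)
  then have cont: "continuous_map euclidean (mtop (mfd G)) c" by (simp add: smooth_map_def)
  have at: "atlas (vector_manifold :: (real, real) manifold) = {(UNIV, id)}"
    by (simp add: vector_manifold_def)
  have inv: "chart_inv (UNIV, id) = (id :: real \<Rightarrow> real)"
    by (auto simp: chart_inv_def inv_into_def fun_eq_iff)
  have "smooth_on {t. c (r * t) \<in> fst k} (snd k \<circ> (\<lambda>t. c (r * t)))" if k: "k \<in> atlas (mfd G)" for k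
    unfolding smooth_on_def
  proof
    fix n
    have "openin (mtop (mfd G)) (fst k)"
      using lie_groupD(2)[OF G] k unfolding smooth_manifold_def by (auto simp: case_prod_beta)
    then have "open {t. c t \<in> fst k}"
      using openin_continuous_map_preimage[OF cont] by simp
    moreover have "higher_differentiable_on n {t. c t \<in> fst k} (snd k \<circ> c)"
      using sm k unfolding smooth_map_def smooth_on_def by (simp add: at inv)
    ultimately show "higher_differentiable_on n {t. c (r * t) \<in> fst k} (snd k \<circ> (\<lambda>t. c (r * t)))"
      using higher_differentiable_on_rescale[of "{t. c t \<in> fst k}" n "snd k \<circ> c" r]
      by (simp add: comp_def)
  qed
  moreover have "continuous_map euclidean (mtop (mfd G)) (\<lambda>t. c (r * t))"
    using continuous_map_compose[OF _ cont, of euclidean "\<lambda>t. r * t"]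
    by (simp add: comp_def continuous_intros)
  ultimately show "one_parameter_subgroup G (\<lambda>t. c (r * t))"
    unfolding one_parameter_subgroup_def smooth_map_def
    by (simp add: at inv C(2) distrib_left)
  have "has_tangent_map vector_manifold vector_manifold (\<lambda>t::real. r * t) 0 (\<lambda>s. r * s)"
    by (rule has_tangent_map_vector) (auto intro!: derivative_eq_intros)
  moreover have "has_tangent_map vector_manifold (mfd G) c (r * 0) (\<lambda>r. r *\<^sub>R velocity (mfd G) c)"
    using C(4) by simp
  ultimately have "has_tangent_map vector_manifold (mfd G) (\<lambda>t. c (r * t)) 0
      (\<lambda>s. (r * s) *\<^sub>R velocity (mfd G) c)"
    by (rule has_tangent_map_compose[OF charted_vector_manifold charted_vector_manifold])
  from tangent_map_eq[OF this] show "velocity (mfd G) (\<lambda>t. c (r * t)) = r *\<^sub>R velocity (mfd G) c"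
    by (simp add: velocity_def)
qed

lemma one_parameter_subgroup_trivial:
  assumes G: "lie_group G"
  shows "one_parameter_subgroup G (\<lambda>_. \<one>\<^bsub>G\<^esub>)" "velocity (mfd G) (\<lambda>_. \<one>\<^bsub>G\<^esub>) = 0"
proof -
  note g = lie_groupD[OF G]
  interpret group G by (rule g(1))
  show "one_parameter_subgroup G (\<lambda>_. \<one>\<^bsub>G\<^esub>)"
    unfolding one_parameter_subgroup_def smooth_map_def smooth_on_def
    using g(4) by (auto simp: comp_def higher_differentiable_on_const)
  show "velocity (mfd G) (\<lambda>_. \<one>\<^bsub>G\<^esub>) = 0"
    using tangent_map_eq[OF has_tangent_map_const[of "0::real" vector_manifold "\<one>\<^bsub>G\<^esub>" "mfd G"]] g(4)
    by (simp add: velocity_def)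
qed

lemma lie_exp_eq:
  assumes G: "lie_group G" and c: "one_parameter_subgroup G c"
  shows "lie_exp G (t *\<^sub>R velocity (mfd G) c) = c t"
proof -
  note r = one_parameter_subgroup_rescale[OF G c, of t]
  have "(THE c'. one_parameter_subgroup G c' \<and> velocity (mfd G) c' = t *\<^sub>R velocity (mfd G) c)
      = (\<lambda>s. c (t * s))"
    using r one_parameter_subgroup_unique[OF G] by (intro the_equality) auto
  then show ?thesis by (simp add: lie_exp_def)
qed

text \<open>
  If no one-parameter subgroup has velocity \<open>\<xi>\<close>, then none has velocity \<open>t *\<^sub>R \<xi>\<close> for any
  \<open>t \<noteq> 0\<close>. The descriptions defining the exponentials then all describe the same, empty,
  set of curves.
\<close>

lemma lie_exp_rescale_if_undefined:
  assumes G: "lie_group G" and no: "\<not> (\<exists>c. one_parameter_subgroup G c \<and> velocity (mfd G) c = \<xi>)"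
    and r: "r \<noteq> 0"
  shows "lie_exp G (t *\<^sub>R r *\<^sub>R \<xi>) = lie_exp G (t *\<^sub>R \<xi>)"
proof (cases "t = 0")
  case False
  have none: "\<not> (one_parameter_subgroup G c \<and> velocity (mfd G) c = s *\<^sub>R \<xi>)" if "s \<noteq> 0" for c s
    using no one_parameter_subgroup_rescale[OF G, of c "inverse s"] that by auto
  have "(\<lambda>c. one_parameter_subgroup G c \<and> velocity (mfd G) c = (t * r) *\<^sub>R \<xi>) =
      (\<lambda>c. one_parameter_subgroup G c \<and> velocity (mfd G) c = t *\<^sub>R \<xi>)"
    using none[of "t * r"] none[of t] False r by (auto simp: fun_eq_iff)
  then show ?thesis by (simp add: lie_exp_def)
qed simp

section \<open>The geometry of a principal bundle with a discrete and a continuous connection\<close>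

text \<open>
  The two laws of an action suffice here. The locale \<^locale>\<open>group_action\<close> also asks the action to
  be extensional, which \<^const>\<open>conj_action\<close> is not.
\<close>

lemma (in group) orbit_eq_iff:
  assumes one: "\<And>x. x \<in> E \<Longrightarrow> \<phi> \<one>\<^bsub>G\<^esub> x = x"
    and mult: "\<And>g h x. g \<in> carrier G \<Longrightarrow> h \<in> carrier G \<Longrightarrow> x \<in> E \<Longrightarrow> \<phi> (g \<otimes>\<^bsub>G\<^esub> h) x = \<phi> g (\<phi> h x)"
    and xy: "x \<in> E" "y \<in> E"
  shows "orbit G \<phi> x = orbit G \<phi> y \<longleftrightarrow> (\<exists>g\<in>carrier G. x = \<phi> g y)"
proof
  have "\<phi> \<one>\<^bsub>G\<^esub> x \<in> orbit G \<phi> x" unfolding orbit_def by blast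
  then have "x \<in> orbit G \<phi> x" by (simp add: one xy)
  moreover assume "orbit G \<phi> x = orbit G \<phi> y"
  ultimately show "\<exists>g\<in>carrier G. x = \<phi> g y" unfolding orbit_def by blast
next
  assume "\<exists>g\<in>carrier G. x = \<phi> g y"
  then obtain g where g: "g \<in> carrier G" "x = \<phi> g y" by blast
  have "\<phi> h y \<in> orbit G \<phi> x" if h: "h \<in> carrier G" for h
  proof -
    have "\<phi> h y = \<phi> (h \<otimes>\<^bsub>G\<^esub> inv\<^bsub>G\<^esub> g \<otimes>\<^bsub>G\<^esub> g) y" using g h by (simp add: m_assoc)
    also have "\<dots> = \<phi> (h \<otimes>\<^bsub>G\<^esub> inv\<^bsub>G\<^esub> g) x"
      unfolding g(2) using g h xy by (intro mult) simp_all
    finally show ?thesis using g h unfolding orbit_def by blast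
  qed
  moreover have "\<phi> h x \<in> orbit G \<phi> y" if h: "h \<in> carrier G" for h
  proof -
    have "\<phi> h x = \<phi> (h \<otimes>\<^bsub>G\<^esub> g) y" using g h xy mult by simp
    then show ?thesis using g h unfolding orbit_def by blast
  qed
  ultimately show "orbit G \<phi> x = orbit G \<phi> y" unfolding orbit_def by blast
qed

locale bundle_with_connections =
  fixes G :: "('g, 'h::model_space) lie_grp"
    and Q :: "('q, 'e::model_space) manifold"
    and B :: "('q set, 'b::model_space) manifold"
    and l :: "'g \<Rightarrow> 'q \<Rightarrow> 'q"
    and \<gamma> :: "'q \<Rightarrow> 'g"
    and A :: "'q \<times> 'q \<Rightarrow> 'g"
    and \<AA> :: "'q \<Rightarrow> 'e \<Rightarrow> 'h"
  assumes lie_group: "lie_group G"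
    and principal: "principal_bundle G Q B l"
    and discrete_connection: "affine_discrete_connection G Q l \<gamma> A"
    and connection: "principal_connection G Q l \<AA>"
begin

sublocale group G
  using lie_groupD(1)[OF lie_group] .

abbreviation proj :: "'q \<Rightarrow> 'q set" where "proj \<equiv> orbit G l"

lemma charted [simp]: "charted (mfd G)" "charted Q" "charted B"
  using lie_groupD(3)[OF lie_group] principal smooth_manifold_imp_charted
  unfolding principal_bundle_def by blast+

lemma charted_products [simp]: "charted (Q \<times>\<^sub>m Q)" "charted (mfd G \<times>\<^sub>m Q)" "charted (mfd G \<times>\<^sub>m B)"
    "charted (Q \<times>\<^sub>m mfd G \<times>\<^sub>m B)" "charted (mfd G \<times>\<^sub>m mfd G)"
  by (simp_all add: charted_prod_manifold)

lemma points_G [simp]: "points (mfd G) = carrier G"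
  using lie_groupD(4)[OF lie_group] .

lemma smooth_maps:
  "smooth_map (mfd G \<times>\<^sub>m Q) Q (\<lambda>(g, q). l g q)" "smooth_map Q B proj"
  "smooth_map (Q \<times>\<^sub>m Q) (mfd G) A"
  using principal discrete_connection
  unfolding principal_bundle_def smooth_action_def affine_discrete_connection_def by blast+

lemma group_action: "group_action G (points Q) l"
  using principal unfolding principal_bundle_def smooth_action_def by blast

lemma act_closed [simp]: "g \<in> carrier G \<Longrightarrow> q \<in> points Q \<Longrightarrow> l g q \<in> points Q"
  using group_action.element_image[OF group_action] by blast

lemma act_one [simp]: "q \<in> points Q \<Longrightarrow> l \<one>\<^bsub>G\<^esub> q = q"
  using group_action.id_eq_one[OF group_action] by (metis restrict_apply')

lemma act_mult: "g \<in> carrier G \<Longrightarrow> h \<in> carrier G \<Longrightarrow> q \<in> points Q \<Longrightarrow> l (g \<otimes>\<^bsub>G\<^esub> h) q = l g (l h q)"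
  using group_action.composition_rule[OF group_action] by blast

lemma proj_eq_iff:
  assumes "p \<in> points Q" "q \<in> points Q"
  shows "proj p = proj q \<longleftrightarrow> (\<exists>g\<in>carrier G. p = l g q)"
  using assms by (intro orbit_eq_iff[where E = "points Q"]) (simp_all add: act_mult)

lemma proj_act [simp]: "g \<in> carrier G \<Longrightarrow> q \<in> points Q \<Longrightarrow> proj (l g q) = proj q"
  using proj_eq_iff[of "l g q" q] by auto

lemma points_B: "points B = proj ` points Q"
  using principal unfolding principal_bundle_def orbits_def by auto

lemma proj_in_B [simp]: "q \<in> points Q \<Longrightarrow> proj q \<in> points B"
  by (simp add: points_B)

lemma A_closed [simp]: "p \<in> points Q \<Longrightarrow> q \<in> points Q \<Longrightarrow> A (p, q) \<in> carrier G"
  using smooth_maps(3) unfolding smooth_map_def continuous_map_def by (auto simp: Pi_iff)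

lemma A_act:
  assumes "p \<in> points Q" "q \<in> points Q" "g \<in> carrier G"
  shows "A (p, l g q) = g \<otimes>\<^bsub>G\<^esub> A (p, q)"
proof -
  have "A (l \<one>\<^bsub>G\<^esub> p, l g q) = g \<otimes>\<^bsub>G\<^esub> A (p, q) \<otimes>\<^bsub>G\<^esub> inv\<^bsub>G\<^esub> \<one>\<^bsub>G\<^esub>"
    using discrete_connection assms one_closed unfolding affine_discrete_connection_def by blast
  then show ?thesis using assms by simp
qed

text \<open>
  The discrete connection turns every orbit into a copy of \<open>G\<close>: \<open>A (p, -)\<close> is an equivariant
  bijection from it to \<open>G\<close>.
\<close>

lemma A_inj_on_orbit:
  assumes pt: "p \<in> points Q" "q \<in> points Q" "q' \<in> points Q"
    and "proj q = proj q'" "A (p, q) = A (p, q')"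
  shows "q = q'"
proof -
  obtain g where g: "g \<in> carrier G" "q = l g q'" using assms proj_eq_iff by blast
  then have "g \<otimes>\<^bsub>G\<^esub> A (p, q') = A (p, q')" using A_act[of p q' g] assms by simp
  then have "g = \<one>\<^bsub>G\<^esub>" using g pt by simp
  then show ?thesis using g pt by simp
qed

text \<open>
  The point of the orbit of \<open>q\<close> at which \<open>A (p, -)\<close> takes the value \<open>w\<close>. Being an explicit
  expression in the structure maps, it is visibly differentiable in all three arguments.
\<close>

definition translate :: "'q \<Rightarrow> 'g \<Rightarrow> 'q \<Rightarrow> 'q" where
  "translate p w q = l (w \<otimes>\<^bsub>G\<^esub> inv\<^bsub>G\<^esub> A (p, q)) q"

lemma translate:
  assumes "p \<in> points Q" "q \<in> points Q" "w \<in> carrier G"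
  shows "translate p w q \<in> points Q" "proj (translate p w q) = proj q" "A (p, translate p w q) = w"
  using assms by (simp_all add: translate_def A_act m_assoc)

lemma translate_A:
  assumes "p \<in> points Q" "q \<in> points Q" "q' \<in> points Q" "proj q = proj q'"
  shows "translate p (A (p, q')) q = q'"
  using assms translate[OF assms(1,2) A_closed[OF assms(1,3)]] by (intro A_inj_on_orbit[of p]) auto

subsection \<open>Differentiability of the structure maps\<close>

lemma differentiable_at_act:
  assumes M: "charted M" and F: "differentiable_at M (mfd G) F p" and H: "differentiable_at M Q H p"
  shows "differentiable_at M Q (\<lambda>x. l (F x) (H x)) p"
proof -
  have pt: "F p \<in> carrier G" "H p \<in> points Q"
    using differentiable_at_points(2)[OF F] differentiable_at_points(2)[OF H] by simp_all
  have "differentiable_at (mfd G \<times>\<^sub>m Q) Q (\<lambda>(g, q). l g q) (F p, H p)"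
    by (rule smooth_map_differentiable_at) (simp_all add: smooth_maps pt)
  from differentiable_at_compose[OF M charted_products(2) differentiable_at_Pair[OF F H] this]
  show ?thesis by simp
qed

lemma differentiable_at_mult:
  assumes M: "charted M" and F: "differentiable_at M (mfd G) F p" and H: "differentiable_at M (mfd G) H p"
  shows "differentiable_at M (mfd G) (\<lambda>x. F x \<otimes>\<^bsub>G\<^esub> H x) p"
proof -
  have pt: "F p \<in> carrier G" "H p \<in> carrier G"
    using differentiable_at_points(2)[OF F] differentiable_at_points(2)[OF H] by simp_all
  have "differentiable_at (mfd G \<times>\<^sub>m mfd G) (mfd G) (\<lambda>(g, h). g \<otimes>\<^bsub>G\<^esub> h) (F p, H p)"
    by (rule smooth_map_differentiable_at) (simp_all add: lie_groupD[OF lie_group] pt)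
  from differentiable_at_compose[OF M charted_products(5) differentiable_at_Pair[OF F H] this]
  show ?thesis by simp
qed

lemma differentiable_at_inv:
  assumes M: "charted M" and F: "differentiable_at M (mfd G) F p"
  shows "differentiable_at M (mfd G) (\<lambda>x. inv\<^bsub>G\<^esub> (F x)) p"
proof (rule differentiable_at_compose[OF M charted(1) F])
  have "F p \<in> points (mfd G)"
    using F by (rule differentiable_at_points)
  then show "differentiable_at (mfd G) (mfd G) (m_inv G) (F p)"
    by (intro smooth_map_differentiable_at) (simp_all add: lie_groupD(6)[OF lie_group])
qed

lemma differentiable_at_A:
  assumes M: "charted M" and F: "differentiable_at M Q F p" and H: "differentiable_at M Q H p"
  shows "differentiable_at M (mfd G) (\<lambda>x. A (F x, H x)) p"
proof (rule differentiable_at_compose[OF M charted_products(1) differentiable_at_Pair[OF F H]])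
  have "F p \<in> points Q" "H p \<in> points Q"
    using differentiable_at_points(2)[OF F] differentiable_at_points(2)[OF H] by simp_all
  then show "differentiable_at (Q \<times>\<^sub>m Q) (mfd G) A (F p, H p)"
    by (intro smooth_map_differentiable_at) (simp_all add: smooth_maps)
qed

lemma differentiable_at_proj:
  "q \<in> points Q \<Longrightarrow> differentiable_at Q B proj q"
  by (rule smooth_map_differentiable_at) (simp_all add: smooth_maps)

lemma differentiable_at_translate:
  assumes M: "charted M" and F: "differentiable_at M Q F p" and W: "differentiable_at M (mfd G) W p"
    and H: "differentiable_at M Q H p"
  shows "differentiable_at M Q (\<lambda>x. translate (F x) (W x) (H x)) p"
  unfolding translate_def
  by (intro differentiable_at_act differentiable_at_mult differentiable_at_inv differentiable_at_A assms)

text \<open>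
  In a local trivialization \<open>\<Theta>\<close>, take the points whose fibre coordinate is that of \<open>q\<close>.
\<close>

lemma local_section:
  assumes q: "q \<in> points Q"
  obtains U s where "openin (mtop B) U" "proj q \<in> U" "s (proj q) = q"
    "\<forall>b\<in>U. s b \<in> points Q \<and> proj (s b) = b" "differentiable_at B Q s (proj q)"
proof -
  have "\<exists>U \<Theta>. openin (mtop B) U \<and> proj q \<in> U \<and>
        diffeomorphism (open_submanifold Q {q \<in> points Q. proj q \<in> U})
          (open_submanifold B U \<times>\<^sub>m mfd G) \<Theta> \<and>
        (\<forall>q \<in> points Q. proj q \<in> U \<longrightarrow> fst (\<Theta> q) = proj q \<and>
           (\<forall>g \<in> carrier G. \<Theta> (l g q) = (proj q, g \<otimes>\<^bsub>G\<^esub> snd (\<Theta> q))))"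
    using principal proj_in_B[OF q] unfolding principal_bundle_def by blast
  then obtain U \<Theta> where U: "openin (mtop B) U" "proj q \<in> U"
    and diff: "diffeomorphism (open_submanifold Q {q \<in> points Q. proj q \<in> U})
          (open_submanifold B U \<times>\<^sub>m mfd G) \<Theta>"
    and fst: "\<And>q. q \<in> points Q \<Longrightarrow> proj q \<in> U \<Longrightarrow> fst (\<Theta> q) = proj q"
    by blast
  define V where "V = {q \<in> points Q. proj q \<in> U}"
  have V: "openin (mtop Q) V"
    using openin_continuous_map_preimage U(1) smooth_maps(2) unfolding V_def smooth_map_def by blast
  let ?QV = "open_submanifold Q V" and ?BU = "open_submanifold B U"
  have ch: "charted ?QV" "charted ?BU" "charted (?BU \<times>\<^sub>m mfd G)"
    using V U by (simp_all add: charted_open_submanifold charted_prod_manifold)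
  have ptV: "points ?QV = V" by (auto simp: V_def)
  have UB: "U \<subseteq> points B" using U(1) by (rule openin_subset)
  have ptU: "points (?BU \<times>\<^sub>m mfd G) = U \<times> carrier G" using UB by auto
  have bij: "bij_betw \<Theta> V (U \<times> carrier G)"
    and inv: "smooth_map (?BU \<times>\<^sub>m mfd G) ?QV (inv_into V \<Theta>)"
    using diff unfolding diffeomorphism_def V_def[symmetric] ptV ptU by blast+
  define k where "k = snd (\<Theta> q)"
  have qV: "q \<in> V" using q U by (simp add: V_def)
  have \<Theta>q: "\<Theta> q = (proj q, k)" using fst[OF q U(2)] by (simp add: k_def prod_eq_iff)
  have k: "k \<in> carrier G" using bij_betwE[OF bij] qV \<Theta>q by auto
  define s where "s = (\<lambda>b. inv_into V \<Theta> (b, k))"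
  have s: "s b \<in> V \<and> \<Theta> (s b) = (b, k)" if "b \<in> U" for b
  proof -
    have im: "\<Theta> ` V = U \<times> carrier G" using bij by (rule bij_betw_imp_surj_on)
    have "(b, k) \<in> \<Theta> ` V" unfolding im using that k by simp
    then show ?thesis unfolding s_def by (simp add: inv_into_into f_inv_into_f)
  qed
  have "has_tangent_map B (?BU \<times>\<^sub>m mfd G) (\<lambda>b. (b, k)) (proj q) (\<lambda>v. (v, 0))"
    by (intro has_tangent_map_Pair has_tangent_map_into_open_submanifold has_tangent_map_const charted U)
      (simp_all add: q k)
  then have "differentiable_at B (?BU \<times>\<^sub>m mfd G) (\<lambda>b. (b, k)) (proj q)"
    by (rule differentiable_atI)
  moreover have "differentiable_at (?BU \<times>\<^sub>m mfd G) ?QV (inv_into V \<Theta>) (proj q, k)"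
    by (rule smooth_map_differentiable_at[OF ch(3,1) inv]) (use U k UB in auto)
  ultimately have "differentiable_at B ?QV s (proj q)"
    unfolding s_def by (rule differentiable_at_compose[OF charted(3) ch(3)])
  moreover have "differentiable_at ?QV Q (\<lambda>x. x) (s (proj q))"
    using has_tangent_map_from_open_submanifold[OF charted(2) V conjunct1[OF s[OF U(2)]]]
    by (rule differentiable_atI)
  ultimately have "differentiable_at B Q s (proj q)"
    by (rule differentiable_at_compose[OF charted(3) ch(1)])
  moreover have "s (proj q) = q"
    unfolding s_def \<Theta>q[symmetric] using bij qV by (simp add: bij_betw_def inv_into_f_f)
  moreover have "s b \<in> points Q \<and> proj (s b) = b" if "b \<in> U" for b
    using s[OF that] fst[of "s b"] by (auto simp: V_def)
  ultimately show thesis using that U by blast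
qed

subsection \<open>Vertical vectors\<close>

text \<open>
  The infinitesimal generator, as the derivative of the orbit map at the identity, without recourse
  to the exponential map.
\<close>

definition vertical :: "'q \<Rightarrow> 'h \<Rightarrow> 'e" where
  "vertical q = tangent_map (mfd G) Q (\<lambda>g. l g q) \<one>\<^bsub>G\<^esub>"

lemma has_tangent_map_orbit:
  assumes q: "q \<in> points Q"
  shows "has_tangent_map (mfd G) Q (\<lambda>g. l g q) \<one>\<^bsub>G\<^esub> (vertical q)"
  unfolding vertical_def
proof (intro differentiable_atD differentiable_at_act charted)
  show "differentiable_at (mfd G) (mfd G) (\<lambda>g. g) \<one>\<^bsub>G\<^esub>"
    by (rule differentiable_atI[OF has_tangent_map_id]) simp_all
  show "differentiable_at (mfd G) Q (\<lambda>_. q) \<one>\<^bsub>G\<^esub>"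
    by (rule differentiable_atI[OF has_tangent_map_const]) (simp_all add: q)
qed

text \<open>
  This needs that \<open>exp\<close> exists, that is, that every \<open>\<xi>\<close> is the velocity of a one-parameter
  subgroup. The principal connection \<open>\<AA>\<close> gives this without solving a differential equation:
  it recovers \<open>\<xi>\<close> from the curves \<open>exp (t \<xi>) q\<close>, so these curves cannot be the same for \<open>\<xi>\<close>
  and \<open>2 \<xi>\<close> unless \<open>\<xi> = 0\<close>, whereas they would be the same if \<open>exp\<close> were undefined on the line
  of \<open>\<xi>\<close>.
\<close>

lemma infinitesimal_generator_eq_vertical:
  assumes q: "q \<in> points Q"
  shows "infinitesimal_generator G Q l \<xi> q = vertical q \<xi>"
proof -
  have conn: "\<AA> q (infinitesimal_generator G Q l \<zeta> q) = \<zeta>" for \<zeta>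
    using connection q unfolding principal_connection_def by blast
  have "\<exists>c. one_parameter_subgroup G c \<and> velocity (mfd G) c = \<xi>"
  proof (rule ccontr)
    assume no: "\<not> ?thesis"
    \<comment> \<open>Both generators are velocities of literally the same curve.\<close>
    then have "infinitesimal_generator G Q l (2 *\<^sub>R \<xi>) q = infinitesimal_generator G Q l \<xi> q"
      unfolding infinitesimal_generator_def
      by (simp only: lie_exp_rescale_if_undefined[OF lie_group] zero_neq_numeral not_False_eq_True)
    then have "2 *\<^sub>R \<xi> = \<xi>" using conn by metis
    then have "\<xi> = 0" by (simp add: scaleR_2)
    then show False using no one_parameter_subgroup_trivial[OF lie_group] by blast
  qed
  then obtain c where c: "one_parameter_subgroup G c" "velocity (mfd G) c = \<xi>" by blast
  note C = one_parameter_subgroupD[OF lie_group c(1)]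
  have "has_tangent_map (mfd G) Q (\<lambda>g. l g q) (c 0) (vertical q)"
    using has_tangent_map_orbit[OF q] C(3) by simp
  from has_tangent_map_compose[OF charted_vector_manifold charted(1) C(4) this]
  have "tangent_map vector_manifold Q (\<lambda>t. l (c t) q) 0 = (\<lambda>r. vertical q (r *\<^sub>R \<xi>))"
    unfolding c(2) by (rule tangent_map_eq)
  then show ?thesis
    using lie_exp_eq[OF lie_group c(1), unfolded c(2)]
    by (simp add: infinitesimal_generator_def velocity_def)
qed

lemma connection_vertical: "q \<in> points Q \<Longrightarrow> \<AA> q (vertical q \<xi>) = \<xi>"
  using connection infinitesimal_generator_eq_vertical[of q \<xi>]
  unfolding principal_connection_def by metis

lemma has_tangent_map_proj: "q \<in> points Q \<Longrightarrow> has_tangent_map Q B proj q (tangent_map Q B proj q)"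
  using differentiable_at_proj by (rule differentiable_atD)

lemma openin_carrier: "openin (mtop (mfd G)) (carrier G)"
  using openin_topspace[of "mtop (mfd G)"] by simp

lemma proj_vertical:
  assumes q: "q \<in> points Q"
  shows "tangent_map Q B proj q (vertical q \<xi>) = 0"
proof -
  have "has_tangent_map Q B proj (l \<one>\<^bsub>G\<^esub> q) (tangent_map Q B proj q)"
    using has_tangent_map_proj q by simp
  from has_tangent_map_compose[OF charted(1,2) has_tangent_map_orbit[OF q] this]
  have 1: "has_tangent_map (mfd G) B (\<lambda>g. proj (l g q)) \<one>\<^bsub>G\<^esub> (\<lambda>\<xi>. tangent_map Q B proj q (vertical q \<xi>))" .
  have "has_tangent_map (mfd G) B (\<lambda>g. proj (l g q)) \<one>\<^bsub>G\<^esub> (\<lambda>_. 0)"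
    by (rule has_tangent_map_cong[OF charted(1)
          has_tangent_map_const[of "\<one>\<^bsub>G\<^esub>" "mfd G" "proj q" B] openin_carrier one_closed])
      (use q in simp_all)
  from has_tangent_map_unique[OF 1 this] show ?thesis by (rule fun_cong)
qed

lemma has_tangent_map_A:
  assumes "p \<in> points Q" "q \<in> points Q"
  shows "has_tangent_map (Q \<times>\<^sub>m Q) (mfd G) A (p, q) (tangent_map (Q \<times>\<^sub>m Q) (mfd G) A (p, q))"
  by (rule smooth_map_has_tangent_map) (simp_all add: assms smooth_maps)

text \<open>
  By \<open>A (p, l g q) = g \<otimes> A (p, q)\<close>, differentiated at \<open>g = e\<close>.
\<close>

lemma A_vertical:
  assumes pq: "p \<in> points Q" "q \<in> points Q"
  shows "tangent_map (Q \<times>\<^sub>m Q) (mfd G) A (p, q) (0, vertical q \<xi>) =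
    tangent_map (mfd G) (mfd G) (\<lambda>x. x \<otimes>\<^bsub>G\<^esub> A (p, q)) \<one>\<^bsub>G\<^esub> \<xi>"
proof -
  have "has_tangent_map Q (mfd G) (\<lambda>y. A (p, y)) (l \<one>\<^bsub>G\<^esub> q) (\<lambda>v. tangent_map (Q \<times>\<^sub>m Q) (mfd G) A (p, q) (0, v))"
    using has_tangent_map_partial(2)[OF charted(2,2) has_tangent_map_A[OF pq]] pq by simp
  from has_tangent_map_compose[OF charted(1,2) has_tangent_map_orbit[OF pq(2)] this]
  have "has_tangent_map (mfd G) (mfd G) (\<lambda>g. A (p, l g q)) \<one>\<^bsub>G\<^esub>
      (\<lambda>\<xi>. tangent_map (Q \<times>\<^sub>m Q) (mfd G) A (p, q) (0, vertical q \<xi>))" .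
  from has_tangent_map_cong[OF charted(1) this openin_carrier one_closed A_act[OF pq]]
  have "has_tangent_map (mfd G) (mfd G) (\<lambda>g. g \<otimes>\<^bsub>G\<^esub> A (p, q)) \<one>\<^bsub>G\<^esub>
      (\<lambda>\<xi>. tangent_map (Q \<times>\<^sub>m Q) (mfd G) A (p, q) (0, vertical q \<xi>))" .
  from tangent_map_eq[OF this] show ?thesis by simp
qed

text \<open>
  Let \<open>s\<close> be a local section through \<open>q\<close>. Every \<open>x\<close> near \<open>q\<close> is \<open>l (g x) (s (\<pi> x))\<close>, where
  \<open>g x = A (q, x) \<otimes> A (q, s (\<pi> x))\<^sup>-\<^sup>1\<close>. Differentiating at \<open>q\<close> gives \<open>v = vertical q (Tg v)\<close>
  if \<open>T\<pi> v = 0\<close>.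
\<close>

lemma proj_zero_imp_vertical:
  assumes q: "q \<in> points Q" and v: "tangent_map Q B proj q v = 0"
  obtains \<xi> where "v = vertical q \<xi>"
proof -
  obtain U s where U: "openin (mtop B) U" "proj q \<in> U" and sq: "s (proj q) = q"
    and sU: "\<forall>b\<in>U. s b \<in> points Q \<and> proj (s b) = b" and ds: "differentiable_at B Q s (proj q)"
    by (rule local_section[OF q])
  note s = bspec[OF sU]
  define V where "V = {q \<in> points Q. proj q \<in> U}"
  have V: "openin (mtop Q) V"
    using openin_continuous_map_preimage U(1) smooth_maps(2) unfolding V_def smooth_map_def by blast
  define g where "g = (\<lambda>x. A (q, x) \<otimes>\<^bsub>G\<^esub> inv\<^bsub>G\<^esub> A (q, s (proj x)))"
  have gx: "l (g x) (s (proj x)) = x" if "x \<in> V" for x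
    using translate_A[of q "s (proj x)" x] that q s[of "proj x"] by (simp add: V_def g_def translate_def)
  have gq: "g q = \<one>\<^bsub>G\<^esub>" using q by (simp add: g_def sq)
  have dsp: "differentiable_at Q Q (\<lambda>x. s (proj x)) q"
    using differentiable_at_compose[OF charted(2,3) differentiable_at_proj[OF q] ds] .
  have dconst: "differentiable_at Q Q (\<lambda>_. q) q"
    using has_tangent_map_const[OF q q] by (rule differentiable_atI)
  have did: "differentiable_at Q Q (\<lambda>x. x) q"
    using has_tangent_map_id[OF charted(2) q] by (rule differentiable_atI)
  have "differentiable_at Q (mfd G) g q"
    unfolding g_def
    by (intro differentiable_at_mult differentiable_at_inv differentiable_at_A charted dsp dconst did)
  then have dg: "has_tangent_map Q (mfd G) g q (tangent_map Q (mfd G) g q)" (is "has_tangent_map _ _ _ _ ?g")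
    by (rule differentiable_atD)
  obtain S where S: "has_tangent_map B Q s (proj q) S"
    using ds unfolding differentiable_at_def by (rule exE)
  obtain D where D: "has_tangent_map (mfd G \<times>\<^sub>m Q) Q (\<lambda>(g, q). l g q) (\<one>\<^bsub>G\<^esub>, q) D"
    using smooth_map_has_tangent_map[OF charted_products(2) charted(2) smooth_maps(1), of "(\<one>\<^bsub>G\<^esub>, q)"] q
    by simp
  have vert: "vertical q = (\<lambda>\<xi>. D (\<xi>, 0))"
    using has_tangent_map_partial(1)[OF charted(1,2) D] has_tangent_map_orbit[OF q]
    by (intro has_tangent_map_unique) simp_all
  have "has_tangent_map Q (mfd G \<times>\<^sub>m Q) (\<lambda>x. (g x, s (proj x))) q (\<lambda>v. (?g v, S (tangent_map Q B proj q v)))"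
    by (intro has_tangent_map_Pair dg has_tangent_map_compose[OF charted(2,3) has_tangent_map_proj[OF q] S])
  moreover have "has_tangent_map (mfd G \<times>\<^sub>m Q) Q (\<lambda>(g, q). l g q) (g q, s (proj q)) D"
    using D by (simp only: gq sq)
  ultimately have "has_tangent_map Q Q (\<lambda>x. (\<lambda>(g, q). l g q) (g x, s (proj x))) q
      (\<lambda>v. D (?g v, S (tangent_map Q B proj q v)))"
    by (rule has_tangent_map_compose[OF charted(2) charted_products(2)])
  then have "has_tangent_map Q Q (\<lambda>x. l (g x) (s (proj x))) q (\<lambda>v. D (?g v, S (tangent_map Q B proj q v)))"
    by simp
  from has_tangent_map_cong[OF charted(2) this V _ gx] q U
  have "has_tangent_map Q Q (\<lambda>x. x) q (\<lambda>v. D (?g v, S (tangent_map Q B proj q v)))"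
    by (simp add: V_def)
  from has_tangent_map_unique[OF has_tangent_map_id[OF charted(2) q] this]
  have "v = D (?g v, S (tangent_map Q B proj q v))" by (rule fun_cong)
  also have "\<dots> = D (?g v, 0)" using linear_0[OF has_tangent_map_linear[OF S]] v by simp
  finally have "v = vertical q (?g v)" by (simp add: vert)
  then show thesis by (rule that)
qed

lemma linear_connection: "q \<in> points Q \<Longrightarrow> linear (\<AA> q)"
  using connection unfolding principal_connection_def one_form_def by blast

text \<open>
  The connection splits every tangent vector into a horizontal part, the lift of its projection, and
  a vertical part.
\<close>

lemma horizontal_lift_proj:
  assumes q: "q \<in> points Q"
  shows "horizontal_lift G Q B l \<AA> q (tangent_map Q B proj q v) = v - vertical q (\<AA> q v)"
  unfolding horizontal_lift_def
proof (rule the_equality)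
  note P = has_tangent_map_linear[OF has_tangent_map_proj[OF q]]
  note Al = linear_connection[OF q]
  show "\<AA> q (v - vertical q (\<AA> q v)) = 0 \<and>
      tangent_map Q B proj q (v - vertical q (\<AA> q v)) = tangent_map Q B proj q v"
    by (simp add: linear_diff[OF P] linear_diff[OF Al] connection_vertical[OF q] proj_vertical[OF q])
  fix v'
  assume v': "\<AA> q v' = 0 \<and> tangent_map Q B proj q v' = tangent_map Q B proj q v"
  then have "tangent_map Q B proj q (v - v') = 0" by (simp add: linear_diff[OF P])
  then obtain \<xi> where \<xi>: "v - v' = vertical q \<xi>" by (rule proj_zero_imp_vertical[OF q])
  then have "\<AA> q v - \<AA> q v' = \<xi>"
    using connection_vertical[OF q, of \<xi>] linear_diff[OF Al, of v v'] by simp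
  then have "\<AA> q v = \<xi>" using v' by simp
  then show "v' = v - vertical q (\<AA> q v)" using \<xi> by (simp add: algebra_simps)
qed

subsection \<open>The diffeomorphism \<open>\<Phi>\<close> and its inverse\<close>

abbreviation \<Phi> :: "'q \<times> 'q \<Rightarrow> 'q \<times> 'g \<times> 'q set" where "\<Phi> \<equiv> Phi_tilde G l A"

abbreviation \<Psi> :: "'q \<times> 'g \<times> 'q set \<Rightarrow> 'q \<times> 'q" where "\<Psi> \<equiv> Psi_tilde G Q l A"

lemma \<Psi>_\<Phi>: "p \<in> points Q \<Longrightarrow> q \<in> points Q \<Longrightarrow> \<Psi> (\<Phi> (p, q)) = (p, q)"
  unfolding Psi_tilde_def
proof (rule inv_into_f_f)
  show "inj_on \<Phi> (points Q \<times> points Q)"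
    by (rule inj_onI) (auto simp: Phi_tilde_def intro: A_inj_on_orbit)
qed simp

lemma has_tangent_map_\<Phi>:
  assumes pq: "p \<in> points Q" "q \<in> points Q"
  shows "has_tangent_map (Q \<times>\<^sub>m Q) (Q \<times>\<^sub>m mfd G \<times>\<^sub>m B) \<Phi> (p, q)
    (\<lambda>v. (fst v, tangent_map (Q \<times>\<^sub>m Q) (mfd G) A (p, q) v, tangent_map Q B proj q (snd v)))"
proof -
  have "has_tangent_map Q B proj (snd (p, q)) (tangent_map Q B proj q)"
    using has_tangent_map_proj pq by simp
  from has_tangent_map_compose[OF charted_products(1) charted(2)
      has_tangent_map_snd[OF charted(2,2) pq] this]
  have "has_tangent_map (Q \<times>\<^sub>m Q) (Q \<times>\<^sub>m mfd G \<times>\<^sub>m B) (\<lambda>x. (fst x, A x, proj (snd x))) (p, q)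
    (\<lambda>v. (fst v, tangent_map (Q \<times>\<^sub>m Q) (mfd G) A (p, q) v, tangent_map Q B proj q (snd v)))"
    by (intro has_tangent_map_Pair has_tangent_map_A has_tangent_map_fst charted pq)
  moreover have "\<Phi> = (\<lambda>x. (fst x, A x, proj (snd x)))"
    by (auto simp: Phi_tilde_def)
  ultimately show ?thesis by simp
qed

text \<open>
  \<open>\<Psi>\<close> keeps the first component \<open>a\<close> and turns \<open>(w, b)\<close> into the point of the orbit \<open>b\<close> where
  \<open>A (a, -) = w\<close>. Such a point is found by starting from any point of the orbit, so a local section
  provides a differentiable formula.
\<close>

lemma differentiable_at_\<Psi>:
  assumes pq: "p \<in> points Q" "q \<in> points Q"
  shows "differentiable_at (Q \<times>\<^sub>m mfd G \<times>\<^sub>m B) (Q \<times>\<^sub>m Q) \<Psi> (\<Phi> (p, q))"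
proof -
  obtain U s where U: "openin (mtop B) U" "proj q \<in> U" and sq: "s (proj q) = q"
    and sU: "\<forall>b\<in>U. s b \<in> points Q \<and> proj (s b) = b" and ds: "differentiable_at B Q s (proj q)"
    by (rule local_section[OF pq(2)])
  note s = bspec[OF sU]
  let ?P = "Q \<times>\<^sub>m mfd G \<times>\<^sub>m B"
  let ?x = "(p, A (p, q), proj q)"
  define W where "W = points Q \<times> carrier G \<times> U"
  have "openin (prod_topology (mtop Q) (prod_topology (mtop (mfd G)) (mtop B))) W"
    unfolding W_def openin_prod_Times_iff using U openin_carrier openin_topspace by blast
  then have W: "openin (mtop ?P) W" by (simp add: prod_manifold_def)
  have xW: "?x \<in> W" using U pq by (simp add: W_def)
  have x: "p \<in> points Q" "A (p, q) \<in> points (mfd G)" "proj q \<in> points B"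
    "(A (p, q), proj q) \<in> points (mfd G \<times>\<^sub>m B)"
    using pq by simp_all
  have d1: "differentiable_at ?P Q fst ?x"
    using has_tangent_map_fst[OF charted(2) charted_products(3) x(1,4)] by (rule differentiable_atI)
  have d2: "differentiable_at ?P (mfd G \<times>\<^sub>m B) snd ?x"
    using has_tangent_map_snd[OF charted(2) charted_products(3) x(1,4)] by (rule differentiable_atI)
  have d3: "differentiable_at ?P (mfd G) (\<lambda>x. fst (snd x)) ?x"
    by (rule differentiable_at_compose[OF charted_products(4,3) d2])
      (simp add: differentiable_atI[OF has_tangent_map_fst[OF charted(1,3) x(2,3)]])
  have d4: "differentiable_at ?P B (\<lambda>x. snd (snd x)) ?x"
    by (rule differentiable_at_compose[OF charted_products(4,3) d2])
      (simp add: differentiable_atI[OF has_tangent_map_snd[OF charted(1,3) x(2,3)]])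
  have d5: "differentiable_at ?P Q (\<lambda>x. s (snd (snd x))) ?x"
    by (rule differentiable_at_compose[OF charted_products(4) charted(3) d4]) (simp add: ds)
  have "differentiable_at ?P (Q \<times>\<^sub>m Q)
      (\<lambda>x. (fst x, translate (fst x) (fst (snd x)) (s (snd (snd x))))) ?x"
    using differentiable_at_Pair[OF d1 differentiable_at_translate[OF charted_products(4) d1 d3 d5]] .
  from differentiable_atD[OF this] obtain D where D: "has_tangent_map ?P (Q \<times>\<^sub>m Q)
      (\<lambda>x. (fst x, translate (fst x) (fst (snd x)) (s (snd (snd x))))) ?x D" ..
  have "(fst x, translate (fst x) (fst (snd x)) (s (snd (snd x)))) = \<Psi> x" if "x \<in> W" for x
  proof -
    obtain a w b where x: "x = (a, w, b)" by (cases x)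
    have mem: "a \<in> points Q" "w \<in> carrier G" "b \<in> U" using that by (auto simp: W_def x)
    note t = translate[OF mem(1) conjunct1[OF s[OF mem(3)]] mem(2)]
    have "x = \<Phi> (a, translate a w (s b))"
      using t s[OF mem(3)] by (simp add: x Phi_tilde_def)
    then have "\<Psi> x = (a, translate a w (s b))" using \<Psi>_\<Phi>[OF mem(1) t(1)] by (simp only:)
    then show ?thesis by (simp add: x)
  qed
  from has_tangent_map_cong[OF charted_products(4) D W xW this] show ?thesis
    unfolding Phi_tilde_def prod.case by (rule differentiable_atI)
qed

text \<open>The chain rule for \<open>\<Psi> \<circ> \<Phi> = id\<close>, with the tangent map of \<open>\<Phi>\<close> written out.\<close>

lemma tangent_map_\<Psi>_\<Phi>:
  assumes pq: "p \<in> points Q" "q \<in> points Q"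
  shows "tangent_map (Q \<times>\<^sub>m mfd G \<times>\<^sub>m B) (Q \<times>\<^sub>m Q) \<Psi> (\<Phi> (p, q))
    (fst v, tangent_map (Q \<times>\<^sub>m Q) (mfd G) A (p, q) v, tangent_map Q B proj q (snd v)) = v"
proof -
  note 1 = has_tangent_map_compose[OF charted_products(1,4) has_tangent_map_\<Phi>[OF pq]
      differentiable_atD[OF differentiable_at_\<Psi>[OF pq]]]
  have W: "openin (mtop (Q \<times>\<^sub>m Q)) (points Q \<times> points Q)"
    using openin_topspace[of "mtop (Q \<times>\<^sub>m Q)"] by simp
  have "has_tangent_map (Q \<times>\<^sub>m Q) (Q \<times>\<^sub>m Q) (\<lambda>x. x) (p, q)
      (\<lambda>v. tangent_map (Q \<times>\<^sub>m mfd G \<times>\<^sub>m B) (Q \<times>\<^sub>m Q) \<Psi> (\<Phi> (p, q))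
    (fst v, tangent_map (Q \<times>\<^sub>m Q) (mfd G) A (p, q) v, tangent_map Q B proj q (snd v)))"
    by (rule has_tangent_map_cong[OF charted_products(1) 1 W]) (use pq \<Psi>_\<Phi> in auto)
  from has_tangent_map_unique[OF this has_tangent_map_id[OF charted_products(1)]] pq
  have "(\<lambda>v. tangent_map (Q \<times>\<^sub>m mfd G \<times>\<^sub>m B) (Q \<times>\<^sub>m Q) \<Psi> (\<Phi> (p, q))
    (fst v, tangent_map (Q \<times>\<^sub>m Q) (mfd G) A (p, q) v, tangent_map Q B proj q (snd v))) = (\<lambda>v. v)"
    by simp
  then show ?thesis by (rule fun_cong)
qed

end

context bundle_with_connections
begin

section \<open>Lifting curves\<close>

lemma conj_quot_eq_iff:
  assumes "p \<in> points Q" "w \<in> carrier G" "q \<in> points Q" "z \<in> carrier G"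
  shows "conj_quot G l (p, w) = conj_quot G l (q, z) \<longleftrightarrow>
    (\<exists>g\<in>carrier G. p = l g q \<and> w = conjugation G g z)"
proof -
  have "conj_quot G l (p, w) = conj_quot G l (q, z) \<longleftrightarrow>
      (\<exists>g\<in>carrier G. (p, w) = conj_action G l g (q, z))"
    unfolding conj_quot_def
  proof (rule orbit_eq_iff[where E = "points Q \<times> carrier G"])
    show "conj_action G l \<one>\<^bsub>G\<^esub> x = x" if "x \<in> points Q \<times> carrier G" for x
      using that by (cases x) (simp add: conj_action_def conjugation_def)
    show "conj_action G l (g \<otimes>\<^bsub>G\<^esub> h) x = conj_action G l g (conj_action G l h x)"
      if "g \<in> carrier G" "h \<in> carrier G" "x \<in> points Q \<times> carrier G" for g h x
      using that by (cases x) (simp add: conj_action_def conjugation_def act_mult m_assoc inv_mult_group)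
  qed (use assms in simp_all)
  then show ?thesis by (simp add: conj_action_def)
qed

lemma conj_quot_inj:
  assumes "p \<in> points Q" "w \<in> carrier G" "z \<in> carrier G"
    and "conj_quot G l (p, w) = conj_quot G l (p, z)"
  shows "w = z"
proof -
  obtain g where g: "g \<in> carrier G" "l g p = p" "w = conjugation G g z"
    using assms(4) unfolding conj_quot_eq_iff[OF assms(1,2,1,3)] by metis
  have "g \<otimes>\<^bsub>G\<^esub> A (p, p) = A (p, p)"
    using A_act[OF assms(1,1) g(1)] unfolding g(2) by (rule sym)
  then have "g = \<one>\<^bsub>G\<^esub>" using g(1) assms(1) by simp
  then show ?thesis using g(3) assms(3) by (simp add: conjugation_def)
qed

lemma conj_proj_conj_quot:
  assumes "p \<in> points Q" "w \<in> carrier G"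
  shows "conj_proj G Q l (conj_quot G l (p, w)) = proj p"
  unfolding conj_proj_def
proof (rule the_equality)
  show "\<exists>q\<in>points Q. \<exists>g\<in>carrier G. conj_quot G l (p, w) = conj_quot G l (q, g) \<and> proj p = proj q"
    using assms by blast
next
  fix b
  assume "\<exists>q\<in>points Q. \<exists>g\<in>carrier G. conj_quot G l (p, w) = conj_quot G l (q, g) \<and> b = proj q"
  then obtain q g where q: "q \<in> points Q" "g \<in> carrier G" "conj_quot G l (p, w) = conj_quot G l (q, g)"
    "b = proj q" by blast
  then show "b = proj p" using conj_quot_eq_iff[OF assms q(1,2)] proj_act by auto
qed

text \<open>
  Every class in the conjugation bundle has a representative over any prescribed point of its orbit.
\<close>

lemma conj_bundle_fibre:
  assumes v: "v \<in> conj_bundle G Q l" and p: "p \<in> points Q" "proj p = conj_proj G Q l v"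
  obtains w where "w \<in> carrier G" "v = conj_quot G l (p, w)"
proof -
  obtain q z where q: "q \<in> points Q" "z \<in> carrier G" "v = conj_quot G l (q, z)"
    using v unfolding conj_bundle_def orbits_def conj_quot_def by blast
  then have "proj p = proj q" using p conj_proj_conj_quot by simp
  then obtain g where g: "g \<in> carrier G" "p = l g q" using proj_eq_iff p q by blast
  have w: "conjugation G g z \<in> carrier G" using g q by (simp add: conjugation_def)
  then have "conj_quot G l (p, conjugation G g z) = v"
    using conj_quot_eq_iff[OF p(1) w q(1,2)] q(3) g by blast
  then show thesis using that w by blast
qed

text \<open>
  Over \<open>p\<close>, the class \<open>v\<close> amounts to an element \<open>w\<close> of \<open>G\<close>, which is unique because the action is
  free. The orbit \<open>b\<close> has exactly one point \<open>q\<close> with \<open>A (p, q) = w\<close>.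
\<close>

lemma Upsilon_lift:
  assumes v: "v \<in> conj_bundle G Q l" and b: "b \<in> points B"
    and p: "p \<in> points Q" "proj p = conj_proj G Q l v"
  shows "\<exists>!q. q \<in> points Q \<and> Upsilon G l A (p, q) = (v, b)"
proof -
  obtain w where w: "w \<in> carrier G" "v = conj_quot G l (p, w)"
    by (rule conj_bundle_fibre[OF v p])
  obtain r where r: "r \<in> points Q" "b = proj r" using b points_B by blast
  show ?thesis
  proof (rule ex1I)
    show "translate p w r \<in> points Q \<and> Upsilon G l A (p, translate p w r) = (v, b)"
      using translate[OF p(1) r(1) w(1)] w r by (simp add: Upsilon_def)
    fix q assume q: "q \<in> points Q \<and> Upsilon G l A (p, q) = (v, b)"
    then have "A (p, q) = w"
      using conj_quot_inj[of p "A (p, q)" w] p w by (simp add: Upsilon_def)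
    then show "q = translate p w r"
      using q r translate[OF p(1) r(1) w(1)]
      by (intro A_inj_on_orbit[OF p(1)]) (simp_all add: Upsilon_def)
  qed
qed

text \<open>
  Iterate the preceding lemma. The compatibility \<open>\<tau> k = conj_proj (v k)\<close> is what makes the endpoint
  of each step a possible starting point of the next one.
\<close>

lemma lifted_curve_unique_existence:
  assumes v: "\<forall>k<N. (v k, \<tau> (k + 1)) \<in> conj_bundle G Q l \<times> points B"
    and \<tau>: "\<forall>k. 1 \<le> k \<and> k \<le> N - 1 \<longrightarrow> \<tau> k = conj_proj G Q l (v k)"
    and q0: "q0 \<in> points Q" "proj q0 = conj_proj G Q l (v 0)"
  shows "\<exists>!q. lifted_curve G Q l A N v \<tau> q0 q"
proof -
  have step: "\<exists>!q. q \<in> points Q \<and> Upsilon G l A (p, q) = (v k, \<tau> (k + 1))"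
    if "k < N" "p \<in> points Q" "proj p = conj_proj G Q l (v k)" for k p
    using Upsilon_lift[of "v k" "\<tau> (k + 1)" p] v that by blast
  have next_proj: "proj r = conj_proj G Q l (v (Suc k))"
    if "Upsilon G l A (p, r) = (v k, \<tau> (k + 1))" "Suc k < N" for k p r
  proof -
    have "proj r = \<tau> (Suc k)" using that(1) by (simp add: Upsilon_def)
    also have "\<dots> = conj_proj G Q l (v (Suc k))" using \<tau> that(2) by simp
    finally show ?thesis .
  qed
  define c where "c = rec_nat q0 (\<lambda>k p. SOME q. q \<in> points Q \<and> Upsilon G l A (p, q) = (v k, \<tau> (k + 1)))"
  have c0: "c 0 = q0" by (simp add: c_def)
  have cS: "c (Suc k) \<in> points Q \<and> Upsilon G l A (c k, c (Suc k)) = (v k, \<tau> (k + 1))"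
    if "k < N" "c k \<in> points Q" "proj (c k) = conj_proj G Q l (v k)" for k
  proof -
    have "c (Suc k) = (SOME q. q \<in> points Q \<and> Upsilon G l A (c k, q) = (v k, \<tau> (k + 1)))"
      by (simp add: c_def)
    then show ?thesis using someI_ex[OF ex1_implies_ex[OF step[OF that]]] by simp
  qed
  have inv: "c k \<in> points Q \<and> proj (c k) = conj_proj G Q l (v k)" if "k < N" for k
    using that
  proof (induction k)
    case 0
    then show ?case using q0 by (simp add: c0)
  next
    case (Suc k)
    then have "c (Suc k) \<in> points Q" "Upsilon G l A (c k, c (Suc k)) = (v k, \<tau> (k + 1))"
      using cS[of k] by simp_all
    then show ?case using next_proj[OF _ Suc.prems] by blast
  qed
  have mem: "c k \<in> points Q" if "k \<le> N" for k
  proof (cases k)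
    case 0
    then show ?thesis using q0 by (simp add: c0)
  next
    case (Suc j)
    then show ?thesis using cS[of j] inv[of j] that by simp
  qed
  have "Upsilon G l A (c k, c (Suc k)) = (v k, \<tau> (k + 1))" if "k < N" for k
    using cS[of k] inv[OF that] that by simp
  then have lift: "lifted_curve G Q l A N v \<tau> q0 (restrict c {0..N})"
    unfolding lifted_curve_def using mem by (simp add: c0)
  show ?thesis
  proof (rule ex1I[where P = "lifted_curve G Q l A N v \<tau> q0", OF lift])
    fix d assume d: "lifted_curve G Q l A N v \<tau> q0 d"
    then have d0: "d 0 = q0" and dU: "\<And>k. k < N \<Longrightarrow> Upsilon G l A (d k, d (Suc k)) = (v k, \<tau> (k + 1))"
      and dE: "d \<in> {0..N} \<rightarrow>\<^sub>E points Q"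
      by (simp_all add: lifted_curve_def)
    have "d k = c k" if "k \<le> N" for k
      using that
    proof (induction k)
      case 0
      show ?case by (simp add: c0 d0)
    next
      case (Suc k)
      then have k: "k < N" "d k = c k" by simp_all
      have "d (Suc k) \<in> points Q" using dE Suc.prems by (intro PiE_mem[OF dE]) simp
      moreover have "Upsilon G l A (c k, d (Suc k)) = (v k, \<tau> (k + 1))"
        using dU[OF k(1)] unfolding k(2) .
      moreover note ck = conjunct1[OF inv[OF k(1)]] conjunct2[OF inv[OF k(1)]]
      ultimately show ?case
        using ex1E[OF step[OF k(1) ck]] cS[OF k(1) ck] by metis
    qed
    then show "d = restrict c {0..N}"
      using lift unfolding lifted_curve_def by (intro PiE_ext[OF dE, of "restrict c {0..N}"]) simp_all
  qed
qed

end

section \<open>The reduced equations\<close>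

locale symmetric_system = bundle_with_connections G Q B l \<gamma> A \<AA>
  for G :: "('g, 'h::model_space) lie_grp"
    and Q :: "('q, 'e::model_space) manifold"
    and B :: "('q set, 'b::model_space) manifold"
    and l \<gamma> A \<AA> +
  fixes L :: "'q \<times> 'q \<Rightarrow> real"
    and f :: "'q \<times> 'q \<Rightarrow> 'e \<times> 'e \<Rightarrow> real"
  assumes smooth_L: "smooth_map (Q \<times>\<^sub>m Q) vector_manifold L"
    and form_f: "one_form (Q \<times>\<^sub>m Q) f"
    and L_invariant: "g \<in> carrier G \<Longrightarrow> p \<in> points Q \<Longrightarrow> q \<in> points Q \<Longrightarrow> L (l g p, l g q) = L (p, q)"
begin

abbreviation dL :: "'q \<times> 'q \<Rightarrow> 'e \<times> 'e \<Rightarrow> real" where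
  "dL \<equiv> differential (Q \<times>\<^sub>m Q) L"

abbreviation dA :: "'q \<times> 'q \<Rightarrow> 'e \<times> 'e \<Rightarrow> 'h" where
  "dA \<equiv> tangent_map (Q \<times>\<^sub>m Q) (mfd G) A"

abbreviation d\<pi> :: "'q \<Rightarrow> 'e \<Rightarrow> 'b" where
  "d\<pi> \<equiv> tangent_map Q B proj"

abbreviation dL_check :: "'q \<times> 'g \<times> 'q set \<Rightarrow> 'e \<times> 'h \<times> 'b \<Rightarrow> real" where
  "dL_check \<equiv> differential (Q \<times>\<^sub>m mfd G \<times>\<^sub>m B) (L_check G Q l A L)"

lemma has_tangent_map_L:
  assumes "p \<in> points Q" "q \<in> points Q"
  shows "has_tangent_map (Q \<times>\<^sub>m Q) vector_manifold L (p, q) (dL (p, q))"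
  by (rule smooth_map_has_tangent_map) (simp_all add: assms smooth_L)

lemma linear_f: "p \<in> points Q \<Longrightarrow> q \<in> points Q \<Longrightarrow> linear (f (p, q))"
  using form_f unfolding one_form_def by simp

text \<open>
  \<open>L = L_check \<circ> \<Phi>\<close> and \<open>f\<close> is the pullback of \<open>f_check\<close> by \<open>\<Phi>\<close>, so the chain rule applies.
\<close>

lemma dL_check_eq:
  assumes pq: "p \<in> points Q" "q \<in> points Q"
  shows "linear (dL_check (\<Phi> (p, q)))"
    and "dL_check (\<Phi> (p, q)) (fst v, dA (p, q) v, d\<pi> q (snd v)) = dL (p, q) v"
proof -
  have "has_tangent_map (Q \<times>\<^sub>m Q) vector_manifold L (\<Psi> (\<Phi> (p, q))) (dL (p, q))"
    using has_tangent_map_L[OF pq] by (simp only: \<Psi>_\<Phi>[OF pq])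
  from has_tangent_map_compose[OF charted_products(4,1) differentiable_atD[OF differentiable_at_\<Psi>[OF pq]] this]
  have D: "has_tangent_map (Q \<times>\<^sub>m mfd G \<times>\<^sub>m B) vector_manifold (L_check G Q l A L) (\<Phi> (p, q))
      (\<lambda>v. dL (p, q) (tangent_map (Q \<times>\<^sub>m mfd G \<times>\<^sub>m B) (Q \<times>\<^sub>m Q) \<Psi> (\<Phi> (p, q)) v))"
    unfolding L_check_def comp_def .
  show "linear (dL_check (\<Phi> (p, q)))"
    unfolding tangent_map_eq[OF D] by (rule has_tangent_map_linear[OF D])
  show "dL_check (\<Phi> (p, q)) (fst v, dA (p, q) v, d\<pi> q (snd v)) = dL (p, q) v"
    unfolding tangent_map_eq[OF D] tangent_map_\<Psi>_\<Phi>[OF pq] ..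
qed

lemma f_check_eq:
  assumes pq: "p \<in> points Q" "q \<in> points Q"
  shows "linear (f_check G Q B l A f (\<Phi> (p, q)))"
    and "f_check G Q B l A f (\<Phi> (p, q)) (fst v, dA (p, q) v, d\<pi> q (snd v)) = f (p, q) v"
proof -
  have eq: "f_check G Q B l A f (\<Phi> (p, q)) =
      (\<lambda>v. f (p, q) (tangent_map (Q \<times>\<^sub>m mfd G \<times>\<^sub>m B) (Q \<times>\<^sub>m Q) \<Psi> (\<Phi> (p, q)) v))"
    unfolding f_check_def pullback_def \<Psi>_\<Phi>[OF pq] ..
  show "linear (f_check G Q B l A f (\<Phi> (p, q)))"
    unfolding eq
    using linear_compose[OF has_tangent_map_linear[OF differentiable_atD[OF differentiable_at_\<Psi>[OF pq]]]
        linear_f[OF pq]]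
    by (simp only: comp_def)
  show "f_check G Q B l A f (\<Phi> (p, q)) (fst v, dA (p, q) v, d\<pi> q (snd v)) = f (p, q) v"
    unfolding eq tangent_map_\<Psi>_\<Phi>[OF pq] ..
qed

text \<open>
  The derivative of the invariance of \<open>L\<close> along the diagonal action.
\<close>

lemma dL_vertical:
  assumes pq: "p \<in> points Q" "q \<in> points Q"
  shows "dL (p, q) (vertical p \<xi>, vertical q \<xi>) = 0"
proof -
  have "has_tangent_map (Q \<times>\<^sub>m Q) vector_manifold L (l \<one>\<^bsub>G\<^esub> p, l \<one>\<^bsub>G\<^esub> q) (dL (p, q))"
    using has_tangent_map_L[OF pq] pq by simp
  from has_tangent_map_compose[OF charted(1) charted_products(1)
      has_tangent_map_Pair[OF has_tangent_map_orbit[OF pq(1)] has_tangent_map_orbit[OF pq(2)]] this]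
  have 1: "has_tangent_map (mfd G) vector_manifold (\<lambda>g. L (l g p, l g q)) \<one>\<^bsub>G\<^esub>
      (\<lambda>\<xi>. dL (p, q) (vertical p \<xi>, vertical q \<xi>))" .
  have "has_tangent_map (mfd G) vector_manifold (\<lambda>g. L (l g p, l g q)) \<one>\<^bsub>G\<^esub> (\<lambda>_. 0)"
    by (rule has_tangent_map_cong[OF charted(1)
          has_tangent_map_const[of "\<one>\<^bsub>G\<^esub>" "mfd G" "L (p, q)" vector_manifold] openin_carrier one_closed])
      (use pq L_invariant in simp_all)
  from has_tangent_map_unique[OF 1 this] show ?thesis by (rule fun_cong)
qed

text \<open>
  The contributions of the vertex \<open>q\<close> to the variation of the action, force included, along \<open>\<dots>, p, q, r, \<dots>\<close>.
\<close>

definition euler_lagrange :: "'q \<Rightarrow> 'q \<Rightarrow> 'q \<Rightarrow> 'e \<Rightarrow> real" where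
  "euler_lagrange p q r v = (dL (q, r) (v, 0) + f (q, r) (v, 0)) + (dL (p, q) (0, v) + f (p, q) (0, v))"

lemma linear_split:
  assumes D: "linear D"
  shows "D (x, y, 0) = D (x, 0, 0) + D (0, y, 0)" "D (0, y, z) = D (0, y, 0) + D (0, 0, z)"
  using linear_add[OF D, of "(x, 0, 0)" "(0, y, 0)"] linear_add[OF D, of "(0, y, 0)" "(0, 0, z)"]
  by simp_all

text \<open>
  The partial derivatives of \<open>L\<close> and the components of \<open>f\<close> in terms of the reduced objects: the first
  point enters \<open>\<Phi>\<close> through its first two components, the second point through the last two.
\<close>

lemma reduced_partials:
  assumes pq: "p \<in> points Q" "q \<in> points Q"
  shows "dL (p, q) (v, 0) = dL_check (\<Phi> (p, q)) (v, 0, 0) + dL_check (\<Phi> (p, q)) (0, dA (p, q) (v, 0), 0)"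
    and "dL (p, q) (0, v) = dL_check (\<Phi> (p, q)) (0, dA (p, q) (0, v), 0) + dL_check (\<Phi> (p, q)) (0, 0, d\<pi> q v)"
    and "f (p, q) (v, 0) = f_check G Q B l A f (\<Phi> (p, q)) (v, 0, 0)
      + f_check G Q B l A f (\<Phi> (p, q)) (0, dA (p, q) (v, 0), 0)"
    and "f (p, q) (0, v) = f_check G Q B l A f (\<Phi> (p, q)) (0, dA (p, q) (0, v), 0)
      + f_check G Q B l A f (\<Phi> (p, q)) (0, 0, d\<pi> q v)"
proof -
  have z: "d\<pi> q 0 = 0"
    by (rule linear_0[OF has_tangent_map_linear[OF has_tangent_map_proj[OF pq(2)]]])
  note S = linear_split[OF dL_check_eq(1)[OF pq]] linear_split[OF f_check_eq(1)[OF pq]]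
  show "dL (p, q) (v, 0) = dL_check (\<Phi> (p, q)) (v, 0, 0) + dL_check (\<Phi> (p, q)) (0, dA (p, q) (v, 0), 0)"
    using dL_check_eq(2)[OF pq, of "(v, 0)"] z S(1)[of v "dA (p, q) (v, 0)"] by simp
  show "dL (p, q) (0, v) = dL_check (\<Phi> (p, q)) (0, dA (p, q) (0, v), 0) + dL_check (\<Phi> (p, q)) (0, 0, d\<pi> q v)"
    using dL_check_eq(2)[OF pq, of "(0, v)"] S(2)[of "dA (p, q) (0, v)" "d\<pi> q v"] by simp
  show "f (p, q) (v, 0) = f_check G Q B l A f (\<Phi> (p, q)) (v, 0, 0)
      + f_check G Q B l A f (\<Phi> (p, q)) (0, dA (p, q) (v, 0), 0)"
    using f_check_eq(2)[OF pq, of "(v, 0)"] z S(3)[of v "dA (p, q) (v, 0)"] by simp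
  show "f (p, q) (0, v) = f_check G Q B l A f (\<Phi> (p, q)) (0, dA (p, q) (0, v), 0)
      + f_check G Q B l A f (\<Phi> (p, q)) (0, 0, d\<pi> q v)"
    using f_check_eq(2)[OF pq, of "(0, v)"] S(4)[of "dA (p, q) (0, v)" "d\<pi> q v"] by simp
qed

lemma euler_lagrange_add:
  assumes "p \<in> points Q" "q \<in> points Q" "r \<in> points Q"
  shows "euler_lagrange p q r (u + v) = euler_lagrange p q r u + euler_lagrange p q r v"
proof -
  note add = linear_add[OF has_tangent_map_linear[OF has_tangent_map_L]] linear_add[OF linear_f]
  have pair: "(u + v, 0::'e) = (u, 0) + (v, 0)" "(0::'e, u + v) = (0, u) + (0, v)" by simp_all
  show ?thesis
    unfolding euler_lagrange_def pair by (simp only: add assms algebra_simps)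
qed

context
  fixes q :: "nat \<Rightarrow> 'q" and \<tau> :: "nat \<Rightarrow> 'q set" and k :: nat
  assumes q: "q k \<in> points Q" "q (Suc k) \<in> points Q" "q (Suc (Suc k)) \<in> points Q"
    and \<tau>: "\<tau> (Suc k) = proj (q (Suc k))" "\<tau> (Suc (Suc k)) = proj (q (Suc (Suc k)))"
begin

lemma \<Phi>_curve:
  "(q k, A (q k, q (Suc k)), \<tau> (Suc k)) = \<Phi> (q k, q (Suc k))"
  "(q (Suc k), A (q (Suc k), q (Suc (Suc k))), \<tau> (Suc (Suc k))) = \<Phi> (q (Suc k), q (Suc (Suc k)))"
  by (simp_all add: \<tau> Phi_tilde_def)

text \<open>
  On horizontal vectors the equation of motion is the first reduced equation, term by term.
\<close>

lemma phi_fd_eq_euler_lagrange: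
  "phi_fd G Q B l A \<AA> L f q \<tau> (Suc k) (d\<pi> (q (Suc k)) v) =
    euler_lagrange (q k) (q (Suc k)) (q (Suc (Suc k))) (v - vertical (q (Suc k)) (\<AA> (q (Suc k)) v))"
proof -
  let ?u = "v - vertical (q (Suc k)) (\<AA> (q (Suc k)) v)"
  have "d\<pi> (q (Suc k)) ?u = d\<pi> (q (Suc k)) v"
    using linear_diff[OF has_tangent_map_linear[OF has_tangent_map_proj[OF q(2)]]] proj_vertical[OF q(2)]
    by simp
  then show ?thesis
    unfolding euler_lagrange_def reduced_partials[OF q(1,2)] reduced_partials[OF q(2,3)] phi_fd_def Let_def
    by (simp add: \<Phi>_curve horizontal_lift_proj[OF q(2)])
qed

text \<open>
  On vertical vectors, \<open>T\<pi>\<close> vanishes and \<open>D\<^sub>2A\<close> is a right translation, so \<open>D\<^sub>2L\<close> at \<open>(p, q)\<close> becomes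
  the first momentum term \<open>D\<^sub>2L_check w\<^sup>-\<^sup>1\<close>. The second one, taken at \<open>(q, r)\<close>, is likewise the value
  of \<open>D\<^sub>2L\<close> on the generator at \<open>r\<close>; invariance of \<open>L\<close> moves it, with a change of sign, to the value
  of \<open>D\<^sub>1L\<close> on the generator at \<open>q\<close>.
\<close>

lemma psi_fd_eq_euler_lagrange:
  "psi_fd G Q B l A L f q \<tau> (Suc k) \<xi> =
    euler_lagrange (q k) (q (Suc k)) (q (Suc (Suc k))) (vertical (q (Suc k)) \<xi>)"
proof -
  let ?p = "q k" and ?q = "q (Suc k)" and ?r = "q (Suc (Suc k))"
  have zero: "dL_check (\<Phi> (?p, ?q)) (0, 0, 0) = 0" "f_check G Q B l A f (\<Phi> (?p, ?q)) (0, 0, 0) = 0"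
    "dL_check (\<Phi> (?q, ?r)) (0, 0, 0) = 0"
    using linear_0[OF dL_check_eq(1)[OF q(1,2)]] linear_0[OF f_check_eq(1)[OF q(1,2)]]
      linear_0[OF dL_check_eq(1)[OF q(2,3)]] by (simp_all add: zero_prod_def)
  have R: "right_translate_covector G (A (?p, ?q)) (snd_of_3 (dL_check (\<Phi> (?p, ?q)))) \<xi> =
      dL (?p, ?q) (0, vertical ?q \<xi>)"
    unfolding right_translate_covector_def reduced_partials(2)[OF q(1,2)]
    by (simp add: A_vertical[OF q(1,2)] proj_vertical[OF q(2)] zero)
  have "dL (?q, ?r) (vertical ?q \<xi>, vertical ?r \<xi>) =
      dL (?q, ?r) (vertical ?q \<xi>, 0) + dL (?q, ?r) (0, vertical ?r \<xi>)"
    using linear_add[OF has_tangent_map_linear[OF has_tangent_map_L[OF q(2,3)]],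
        of "(vertical ?q \<xi>, 0)" "(0, vertical ?r \<xi>)"] by simp
  moreover have "right_translate_covector G (A (?q, ?r)) (snd_of_3 (dL_check (\<Phi> (?q, ?r)))) \<xi> =
      dL (?q, ?r) (0, vertical ?r \<xi>)"
    unfolding right_translate_covector_def reduced_partials(2)[OF q(2,3)]
    by (simp add: A_vertical[OF q(2,3)] proj_vertical[OF q(3)] zero)
  ultimately have "right_translate_covector G (A (?q, ?r)) (snd_of_3 (dL_check (\<Phi> (?q, ?r)))) \<xi> =
      - dL (?q, ?r) (vertical ?q \<xi>, 0)"
    using dL_vertical[OF q(2,3), of \<xi>] by simp
  then show ?thesis
    unfolding euler_lagrange_def psi_fd_def Let_def infinitesimal_generator_eq_vertical[OF q(2)]
      reduced_partials(3)[OF q(2,3)] reduced_partials(4)[OF q(1,2)]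
    by (simp add: \<Phi>_curve R proj_vertical[OF q(2)] zero)
qed

lemma euler_lagrange_zero:
  assumes "\<And>u. phi_fd G Q B l A \<AA> L f q \<tau> (Suc k) u = 0"
    and "\<And>\<xi>. psi_fd G Q B l A L f q \<tau> (Suc k) \<xi> = 0"
  shows "euler_lagrange (q k) (q (Suc k)) (q (Suc (Suc k))) v = 0"
proof -
  let ?h = "vertical (q (Suc k)) (\<AA> (q (Suc k)) v)"
  have "euler_lagrange (q k) (q (Suc k)) (q (Suc (Suc k))) ((v - ?h) + ?h) = 0"
    unfolding euler_lagrange_add[OF q] phi_fd_eq_euler_lagrange[symmetric]
      psi_fd_eq_euler_lagrange[symmetric] using assms by simp
  then show ?thesis by simp
qed

end

text \<open>
  Summation by parts: collect the terms of the variation that contain \<open>\<delta> k\<close>. Those of the two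
  endpoints vanish.
\<close>

lemma trajectory_if_euler_lagrange:
  assumes N: "N \<ge> 1" and q: "\<And>k. k \<le> N \<Longrightarrow> q k \<in> points Q"
    and EL: "\<And>k v. Suc k < N \<Longrightarrow> euler_lagrange (q k) (q (Suc k)) (q (Suc (Suc k))) v = 0"
  shows "trajectory Q L f N q"
  unfolding trajectory_def
proof (intro conjI allI impI)
  fix \<delta> :: "nat \<Rightarrow> 'e" assume \<delta>: "\<delta> 0 = 0 \<and> \<delta> N = 0"
  obtain M where M: "N = Suc M" using N by (cases N) auto
  define a where "a k = dL (q k, q (Suc k)) (\<delta> k, 0) + f (q k, q (Suc k)) (\<delta> k, 0)" for k
  define b where "b k = dL (q k, q (Suc k)) (0, \<delta> (Suc k)) + f (q k, q (Suc k)) (0, \<delta> (Suc k))" for k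
  have split: "D (u, v) = D (u, 0) + D (0, v)" if "linear D" for D :: "'e \<times> 'e \<Rightarrow> real" and u v
    using linear_add[OF that, of "(u, 0)" "(0, v)"] by simp
  have zero: "D (0, 0) = 0" if "linear D" for D :: "'e \<times> 'e \<Rightarrow> real"
    using linear_0[OF that] by (simp add: zero_prod_def)
  have lin: "linear (dL (q k, q (Suc k)))" "linear (f (q k, q (Suc k)))" if "k < N" for k
    using has_tangent_map_linear[OF has_tangent_map_L] linear_f q that by simp_all
  have "(\<Sum>k<N. dL (q k, q (k + 1)) (\<delta> k, \<delta> (k + 1))) + (\<Sum>k<N. f (q k, q (k + 1)) (\<delta> k, \<delta> (k + 1)))
      = (\<Sum>k<N. a k + b k)"
    unfolding sum.distrib[symmetric]
  proof (rule sum.cong)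
    fix k assume "k \<in> {..<N}"
    then have k: "k < N" by simp
    show "dL (q k, q (k + 1)) (\<delta> k, \<delta> (k + 1)) + f (q k, q (k + 1)) (\<delta> k, \<delta> (k + 1)) = a k + b k"
      using split[OF lin(1)[OF k], of "\<delta> k" "\<delta> (Suc k)"] split[OF lin(2)[OF k], of "\<delta> k" "\<delta> (Suc k)"]
      by (simp add: a_def b_def)
  qed simp
  also have "\<dots> = (\<Sum>k<Suc M. a k) + (\<Sum>k<Suc M. b k)"
    by (simp add: sum.distrib M)
  also have "\<dots> = (a 0 + (\<Sum>k<M. a (Suc k))) + ((\<Sum>k<M. b k) + b M)"
    by (simp only: sum.lessThan_Suc_shift[of a] sum.lessThan_Suc[of b])
  also have "\<dots> = (\<Sum>k<M. a (Suc k) + b k)"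
    using zero[OF lin(1)[of 0]] zero[OF lin(2)[of 0]] zero[OF lin(1)[of M]] zero[OF lin(2)[of M]] \<delta>
    by (simp add: a_def b_def M sum.distrib)
  also have "\<dots> = 0"
  proof (rule sum.neutral, rule ballI)
    fix k assume "k \<in> {..<M}"
    then show "a (Suc k) + b k = 0"
      using EL[of k "\<delta> (Suc k)"] by (simp add: a_def b_def euler_lagrange_def M)
  qed
  finally show "(\<Sum>k<N. dL (q k, q (k + 1)) (\<delta> k, \<delta> (k + 1))) +
      (\<Sum>k<N. f (q k, q (k + 1)) (\<delta> k, \<delta> (k + 1))) = 0" .
qed (use q in auto)

end

theorem theorem3p15:
  fixes G :: "('g, 'h::model_space) lie_grp"
    and Q :: "('q, 'e::model_space) manifold"
    and B :: "('q set, 'b::model_space) manifold"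
    and l :: "'g \<Rightarrow> 'q \<Rightarrow> 'q"
    and \<gamma> :: "'q \<Rightarrow> 'g"
    and A\<^sub>d :: "'q \<times> 'q \<Rightarrow> 'g"
    and \<AA> :: "'q \<Rightarrow> 'e \<Rightarrow> 'h"
    and L :: "'q \<times> 'q \<Rightarrow> real"
    and f :: "'q \<times> 'q \<Rightarrow> 'e \<times> 'e \<Rightarrow> real"
    and N :: nat
    and v :: "nat \<Rightarrow> ('q \<times> 'g) set"
    and \<tau> :: "nat \<Rightarrow> 'q set"
  assumes "lie_group G"
    and "principal_bundle G Q B l"
    and "affine_discrete_connection G Q l \<gamma> A\<^sub>d"
    and "principal_connection G Q l \<AA>"
    and "forced_discrete_system Q L f"
    and "symmetry_group G Q B l L f"
    and "N \<ge> 1"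
    and "\<forall>k<N. (v k, \<tau> (k + 1)) \<in> conj_bundle G Q l \<times> points B"
    and "\<forall>k. 1 \<le> k \<and> k \<le> N - 1 \<longrightarrow> \<tau> k = conj_proj G Q l (v k)"
  shows "\<forall>q\<^sub>0 \<in> points Q. orbit G l q\<^sub>0 = conj_proj G Q l (v 0) \<longrightarrow>
    (\<exists>!q. lifted_curve G Q l A\<^sub>d N v \<tau> q\<^sub>0 q) \<and>
    (\<forall>q. lifted_curve G Q l A\<^sub>d N v \<tau> q\<^sub>0 q \<longrightarrow>
       (\<forall>k. 1 \<le> k \<and> k \<le> N - 1 \<longrightarrow>
          (\<forall>u. phi_fd G Q B l A\<^sub>d \<AA> L f q \<tau> k u = 0) \<and>
          (\<forall>\<xi>. psi_fd G Q B l A\<^sub>d L f q \<tau> k \<xi> = 0)) \<longrightarrow>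
       trajectory Q L f N q)"
proof (intro ballI impI conjI allI)
  interpret symmetric_system G Q B l \<gamma> A\<^sub>d \<AA> L f
  proof (unfold_locales)
    show "smooth_map (Q \<times>\<^sub>m Q) vector_manifold L" "one_form (Q \<times>\<^sub>m Q) f"
      using assms(5) unfolding forced_discrete_system_def by simp_all
    show "L (l g p, l g q) = L (p, q)" if "g \<in> carrier G" "p \<in> points Q" "q \<in> points Q" for g p q
    proof -
      have "L (map_prod (l g) (l g) (p, q)) = L (p, q)"
        using assms(6) that unfolding symmetry_group_def by simp
      then show ?thesis by simp
    qed
  qed (fact assms)+
  fix q\<^sub>0 assume q0: "q\<^sub>0 \<in> points Q" "orbit G l q\<^sub>0 = conj_proj G Q l (v 0)"
  show "\<exists>!q. lifted_curve G Q l A\<^sub>d N v \<tau> q\<^sub>0 q"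
    by (rule lifted_curve_unique_existence[OF assms(8,9) q0])
  fix q assume lift: "lifted_curve G Q l A\<^sub>d N v \<tau> q\<^sub>0 q"
    and eqs: "\<forall>k. 1 \<le> k \<and> k \<le> N - 1 \<longrightarrow>
          (\<forall>u. phi_fd G Q B l A\<^sub>d \<AA> L f q \<tau> k u = 0) \<and>
          (\<forall>\<xi>. psi_fd G Q B l A\<^sub>d L f q \<tau> k \<xi> = 0)"
  have q: "q k \<in> points Q" if "k \<le> N" for k
    using lift that unfolding lifted_curve_def by auto
  have \<tau>: "\<tau> (Suc k) = orbit G l (q (Suc k))" if "k < N" for k
    using lift that unfolding lifted_curve_def Upsilon_def by simp
  show "trajectory Q L f N q"
  proof (rule trajectory_if_euler_lagrange[OF assms(7) q])
    show "euler_lagrange (q k) (q (Suc k)) (q (Suc (Suc k))) u = 0" if k: "Suc k < N" for k u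
      by (rule euler_lagrange_zero[where \<tau> = \<tau>]) (use k q \<tau> eqs in auto)
  qed
qed

end
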